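(* Let $\mathcal E$ be a Hilbert space and let $\{F_m\}_{m=1}^\infty$ be a uniformly bounded sequence of free holomorphic functions on $[B(\mathcal H)^n]_1$ with coefficients in $B(\mathcal E)$. Let $\{A^{(k)}\}_{k=1}^\infty\subset[B(\mathcal H)^n]_1$ be a sequence with the following properties: (i) $A^{(k)}$ is bounded below, for each $k=1,2,\dots$; (ii) $\lim_{k\to\infty}\|A^{(k)}\|=0$; (iii) $\lim_{m\to\infty}F_m(A^{(k)})$ exists in the operator norm topology, for each $k=1,2,\dots$. Then there exists a free holomorphic function $F$ on $[B(\mathcal H)^n]_1$ with coefficients in $B(\mathcal E)$ such that $F_m$ converges to $F$ uniformly (in operator norm) on any closed ball $[B(\mathcal H)^n]_r^-$, $r\in[0,1)$.
   Context: $\mathcal H$ is a separable infinite dimensional Hilbert space and $n\in\{1,2,\dots\}\cup\{\infty\}$. A tuple $X=(X_1,\dots,X_n)\in B(\mathcal H)^n$ is identified with the row operator $[X_1\,\cdots\,X_n]:\mathcal H^{(n)}\to\mathcal H$ ($\mathcal H^{(n)}$ the direct sum of $n$ copies of $\mathcal H$); $\|X\|=\|\sum_iX_iX_i^*\|^{1/2}$, $[B(\mathcal H)^n]_1=\{X:\|X\|<1\}$, $[B(\mathcal H)^n]_r^-=\{X:\|X\|\le r\}$. A tuple $A$ is bounded below if the row operator is: there is $C>0$ with $\|Ay\|\ge C\|y\|$ for all $y\in\mathcal H^{(n)}$. $\mathbb F_n^+$ is the unital free semigroup on $g_1,\dots,g_n$; for $\alpha=g_{i_1}\cdots g_{i_k}$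 put $|\alpha|=k$, $X_\alpha=X_{i_1}\cdots X_{i_k}$ ($X_\alpha=I$ for the neutral element, of length $0$). A free holomorphic function on $[B(\mathcal H)^n]_1$ with coefficients in $B(\mathcal E)$ is a map $F(X)=\sum_{k=0}^\infty\sum_{|\alpha|=k}X_\alpha\otimes A_{(\alpha)}$ with $A_{(\alpha)}\in B(\mathcal E)$, the series in $k$ converging in operator norm for all $X\in[B(\mathcal H)^n]_1$. Uniformly bounded means there is $M>0$ with $\|F_m(X)\|\le M$ for all $X\in[B(\mathcal H)^n]_1$ and all $m$. *)

theory Defs
  imports "HOL-Analysis.Analysis"
begin

section \<open>Complex Hilbert spaces\<close>

class complex_vector = real_vector +
  fixes scaleC :: "complex \<Rightarrow> 'a \<Rightarrow> 'a" (infixr "*\<^sub>C" 75)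
  assumes scaleC_add_right: "a *\<^sub>C (x + y) = a *\<^sub>C x + a *\<^sub>C y"
    and scaleC_add_left: "(a + b) *\<^sub>C x = a *\<^sub>C x + b *\<^sub>C x"
    and scaleC_scaleC: "a *\<^sub>C b *\<^sub>C x = (a * b) *\<^sub>C x"
    and scaleC_one: "1 *\<^sub>C x = x"
    and scaleR_scaleC: "r *\<^sub>R x = complex_of_real r *\<^sub>C x"

global_interpretation complex_vector:
  vector_space "scaleC :: complex \<Rightarrow> 'a \<Rightarrow> 'a::complex_vector"
  defines cspan = complex_vector.span
  by unfold_locales
    (simp_all add: scaleC_add_right scaleC_add_left scaleC_scaleC scaleC_one)

text \<open>The inner product is linear in its first argument. Positivity and definiteness are
  consequences of the last axiom, since \<^term>\<open>sqrt\<close> is negative on negative reals.\<close>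

class complex_inner = complex_vector + real_normed_vector +
  fixes cinner :: "'a \<Rightarrow> 'a \<Rightarrow> complex"
  assumes cinner_commute: "cinner x y = cnj (cinner y x)"
    and cinner_add_left: "cinner (x + y) z = cinner x z + cinner y z"
    and cinner_scaleC_left: "cinner (a *\<^sub>C x) y = a * cinner x y"
    and norm_eq_sqrt_cinner: "norm x = sqrt (Re (cinner x x))"

class chilbert_space = complex_inner + complete_space

instantiation complex :: chilbert_space
begin

definition scaleC_complex :: "complex \<Rightarrow> complex \<Rightarrow> complex"
  where "scaleC_complex a x = a * x"

definition cinner_complex :: "complex \<Rightarrow> complex \<Rightarrow> complex"
  where "cinner_complex x y = x * cnj y"

instance
  by intro_classes
    (simp_all add: scaleC_complex_def cinner_complex_def algebra_simps scaleR_conv_of_real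
      cmod_def power2_eq_square)

end


section \<open>Bounded operators\<close>

text \<open>The type \<^typ>\<open>'a \<Rightarrow>\<^sub>L 'b\<close> consists of the bounded real-linear maps. The space of bounded
  operators between complex spaces is its subset of complex-linear maps; the norm of
  \<^typ>\<open>'a \<Rightarrow>\<^sub>L 'b\<close> restricts to the usual operator norm on it.\<close>

definition cblin :: "('a::complex_inner \<Rightarrow>\<^sub>L 'b::complex_inner) set"
  where "cblin = {T. \<forall>c x. blinfun_apply T (c *\<^sub>C x) = c *\<^sub>C blinfun_apply T x}"

definition adj :: "('a::chilbert_space \<Rightarrow>\<^sub>L 'b::chilbert_space) \<Rightarrow> ('b \<Rightarrow>\<^sub>L 'a)"
  where "adj T = (THE S. \<forall>x y. cinner (T x) y = cinner x (blinfun_apply S y))"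


section \<open>Row operators\<close>

text \<open>A tuple of operators is indexed by a countable type, which has cardinality
  \<open>n \<in> {1, 2, \<dots>} \<union> {\<infinity>}\<close>. If the index type is infinite, the sum of the \<open>X\<^sub>i X\<^sub>i\<^sup>*\<close> is taken in
  the strong operator topology. It exists precisely when the row operator
  \<open>[X\<^sub>1 X\<^sub>2 \<cdots>]\<close> is bounded on the Hilbert space direct sum.\<close>

definition has_row_square ::
    "('n::countable \<Rightarrow> 'h::chilbert_space \<Rightarrow>\<^sub>L 'h) \<Rightarrow> ('h \<Rightarrow>\<^sub>L 'h) \<Rightarrow> bool"
  where "has_row_square X G \<longleftrightarrow> (\<forall>h. ((\<lambda>i. (X i o\<^sub>L adj (X i)) h) has_sum G h) UNIV)"

definition row_tuples :: "('n::countable \<Rightarrow> 'h::chilbert_space \<Rightarrow>\<^sub>L 'h) set"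
  where "row_tuples = {X. (\<forall>i. X i \<in> cblin) \<and> (\<exists>G. has_row_square X G)}"

definition row_norm :: "('n::countable \<Rightarrow> 'h::chilbert_space \<Rightarrow>\<^sub>L 'h) \<Rightarrow> real"
  where "row_norm X = sqrt (norm (THE G. has_row_square X G))"

definition row_ball :: "real \<Rightarrow> ('n::countable \<Rightarrow> 'h::chilbert_space \<Rightarrow>\<^sub>L 'h) set"
  where "row_ball r = {X \<in> row_tuples. row_norm X < r}"

definition row_cball :: "real \<Rightarrow> ('n::countable \<Rightarrow> 'h::chilbert_space \<Rightarrow>\<^sub>L 'h) set"
  where "row_cball r = {X \<in> row_tuples. row_norm X \<le> r}"

text \<open>The vectors of the direct sum \<open>\<H>\<^sup>(\<^sup>n\<^sup>)\<close> are the square-summable families.\<close>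

definition row_bounded_below :: "('n::countable \<Rightarrow> 'h::chilbert_space \<Rightarrow>\<^sub>L 'h) \<Rightarrow> bool"
  where "row_bounded_below X \<longleftrightarrow>
    (\<exists>C>0. \<forall>y. (\<lambda>i. (norm (y i))\<^sup>2) summable_on UNIV \<longrightarrow>
       norm (\<Sum>\<^sub>\<infinity>i. X i (y i)) \<ge> C * sqrt (\<Sum>\<^sub>\<infinity>i. (norm (y i))\<^sup>2))"


section \<open>Hilbert space tensor products\<close>

text \<open>A Hilbert space \<^typ>\<open>'t\<close> with a map \<open>ten\<close> is the tensor product of \<^typ>\<open>'h\<close> and \<^typ>\<open>'e\<close>
  if it is a completion of the algebraic tensor product with the inner product
  \<open>\<langle>h \<otimes> e, h' \<otimes> e'\<rangle> = \<langle>h, h'\<rangle> \<langle>e, e'\<rangle>\<close>; this determines it up to a unique unitary compatible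
  with \<open>ten\<close>.\<close>

definition hilbert_tensor ::
    "('h::chilbert_space \<Rightarrow> 'e::chilbert_space \<Rightarrow> 't::chilbert_space) \<Rightarrow> bool"
  where "hilbert_tensor ten \<longleftrightarrow>
    (\<forall>h h' e. ten (h + h') e = ten h e + ten h' e) \<and>
    (\<forall>h e e'. ten h (e + e') = ten h e + ten h e') \<and>
    (\<forall>c h e. ten (c *\<^sub>C h) e = c *\<^sub>C ten h e \<and> ten h (c *\<^sub>C e) = c *\<^sub>C ten h e) \<and>
    (\<forall>h h' e e'. cinner (ten h e) (ten h' e') = cinner h h' * cinner e e') \<and>
    closure (cspan {ten h e |h e. True}) = UNIV"

lemma hilbert_tensor_scalars:
  "hilbert_tensor (\<lambda>(h::'h::chilbert_space) (c::complex). c *\<^sub>C h)"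
proof -
  have right: "cinner (x::'h) (c *\<^sub>C y) = cnj c * cinner x y" for c x y
    by (metis cinner_commute cinner_scaleC_left complex_cnj_mult)
  have "{c *\<^sub>C h |(h::'h) (c::complex). True} = UNIV"
    using scaleC_one by (metis (mono_tags, lifting) UNIV_eq_I mem_Collect_eq)
  then have "closure (cspan {c *\<^sub>C h |(h::'h) (c::complex). True}) = UNIV"
    by simp
  then show ?thesis
    by (simp add: hilbert_tensor_def right cinner_scaleC_left scaleC_add_right
        scaleC_add_left scaleC_scaleC scaleC_complex_def cinner_complex_def mult.commute
        mult.left_commute)
qed

definition op_tensor ::
    "('h::chilbert_space \<Rightarrow> 'e::chilbert_space \<Rightarrow> 't::chilbert_space) \<Rightarrow>
     ('h \<Rightarrow>\<^sub>L 'h) \<Rightarrow> ('e \<Rightarrow>\<^sub>L 'e) \<Rightarrow> ('t \<Rightarrow>\<^sub>L 't)"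
  where "op_tensor ten X A =
    (THE T. T \<in> cblin \<and> (\<forall>h e. blinfun_apply T (ten h e) = ten (X h) (A e)))"


section \<open>Free holomorphic functions\<close>

text \<open>The free semigroup is the type of lists over the index type, with length \<open>|\<alpha>|\<close>.\<close>

definition word_op :: "('n \<Rightarrow> 'h::real_normed_vector \<Rightarrow>\<^sub>L 'h) \<Rightarrow> 'n list \<Rightarrow> ('h \<Rightarrow>\<^sub>L 'h)"
  where "word_op X \<alpha> = foldr (\<lambda>i T. X i o\<^sub>L T) \<alpha> id_blinfun"

text \<open>The homogeneous terms \<open>P k = \<Sum>\<^bsub>|\<alpha>|=k\<^esub> X\<^sub>\<alpha> \<otimes> A\<^sub>\<alpha>\<close> are finite sums if the index type is finite.
  Otherwise they converge in the strong operator topology, as in the model case of a row of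
  left creation operators against a bounded column of coefficients. The series over \<open>k\<close>
  converges in operator norm. Only the values of the function on the open unit ball matter.\<close>

definition free_holomorphic ::
    "('h::chilbert_space \<Rightarrow> 'e::chilbert_space \<Rightarrow> 't::chilbert_space) \<Rightarrow>
     (('n::countable \<Rightarrow> 'h \<Rightarrow>\<^sub>L 'h) \<Rightarrow> ('t \<Rightarrow>\<^sub>L 't)) \<Rightarrow> bool"
  where "free_holomorphic ten F \<longleftrightarrow>
    (\<exists>A :: 'n list \<Rightarrow> 'e \<Rightarrow>\<^sub>L 'e. (\<forall>\<alpha>. A \<alpha> \<in> cblin) \<and>
      (\<forall>X \<in> row_ball 1. \<exists>P :: nat \<Rightarrow> 't \<Rightarrow>\<^sub>L 't.
        (\<forall>k u. ((\<lambda>\<alpha>. blinfun_apply (op_tensor ten (word_op X \<alpha>) (A \<alpha>)) u) has_sum blinfun_apply (P k) u) {\<alpha>. length \<alpha> = k}) \<and>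
        P sums F X))"

end

theory Submission
  imports Defs
begin

text \<open>
  A free holomorphic function is a series \<open>F X = \<Sum> X\<^sub>\<alpha> \<otimes> A\<^sub>\<alpha>\<close> over all words \<open>\<alpha>\<close>, and the proof
  works with its coefficients. Say that the coefficients on a set \<open>W\<close> of words are bounded by \<open>c\<close> if
  the column they form has norm at most \<open>c\<close>, that is \<open>\<Sum> \<parallel>A\<^sub>\<alpha> x\<parallel>\<^sup>2 \<le> c\<^sup>2 \<parallel>x\<parallel>\<^sup>2\<close> with the sum over \<open>W\<close>.

  If \<open>\<parallel>F\<parallel> \<le> M\<close> on the unit ball, then the column of all coefficients is bounded by \<open>M\<close>
  (\<open>coefficient_column_bound\<close>). The test points are multiples, by factors \<open>r < 1\<close>, of shifts
  \<open>e\<^sub>\<beta> \<mapsto> e\<^bsub>i\<beta>\<^esub>\<close> on a finite orthonormal family indexed by words: there the series is finite, and applied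
  to \<open>e\<^bsub>[]\<^esub> \<otimes> x\<close> it gives the orthogonal sum of the vectors \<open>r\<^bsup>|\<alpha>|\<^esup> e\<^sub>\<alpha> \<otimes> A\<^sub>\<alpha> x\<close>. Conversely, for a row
  \<open>X\<close> of norm at most \<open>r < 1\<close> the row of all \<open>X\<^sub>\<alpha>\<close> with \<open>|\<alpha>| \<ge> k\<close> has norm at most
  \<open>r\<^sup>k / \<surd>(1 - r\<^sup>2)\<close> (\<open>row_upper_words\<close>), so a bounded column of coefficients defines a free
  holomorphic function, with geometric control of the tails.

  It remains to see that, for each \<open>k\<close>, the coefficients of the \<open>F\<^sub>m\<close> on words of length less than
  \<open>k\<close> form a Cauchy sequence in the column norm (\<open>coefficients_Cauchy\<close>). This is an induction on
  \<open>k\<close>. Let \<open>D\<^sub>\<alpha>\<close> be the coefficients of \<open>F\<^sub>m - F\<^sub>j\<close>. At a point \<open>X\<close> of the sequence, the value of the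
  series of \<open>D\<close> and its part of degree less than \<open>k\<close> are small for large \<open>m\<close> and \<open>j\<close>, hence so is the part
  \<open>\<Sum> X\<^sub>\<alpha> (D\<^sub>\<alpha> + \<Sum> X\<^sub>\<beta> D\<^bsub>\<alpha>\<beta>\<^esub>)\<close> of degree at least \<open>k\<close>, where \<open>|\<alpha>| = k\<close>, \<open>|\<beta>| \<ge> 1\<close> and the tensor
  products are suppressed. Since \<open>X\<close> is bounded below by some \<open>C\<close>, the row of the \<open>X\<^sub>\<alpha>\<close> is bounded
  below by \<open>C\<^sup>k\<close>, so the column of the expressions in parentheses is small (\<open>row_lower_words\<close>). The
  inner sums contribute at most \<open>2 M \<parallel>X\<parallel> / \<surd>(1 - \<parallel>X\<parallel>\<^sup>2)\<close>, which is uniform in \<open>m\<close> and \<open>j\<close> and is made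
  small in advance by the choice of \<open>X\<close>, because the norms tend to zero.

  Estimates for rows and columns pass from \<open>\<H>\<close> and \<open>\<E>\<close> to the tensor product slice by slice: a
  finite sum of elementary tensors can be written along an orthonormal set in one of the factors
  (\<open>common_slices_exist\<close>).
\<close>



section \<open>Complex inner products\<close>

lemma cinner_add_right: "cinner x (y + z) = cinner x y + cinner x z"
  by (metis cinner_commute cinner_add_left complex_cnj_add)

lemma cinner_scaleC_right: "cinner x (a *\<^sub>C y) = cnj a * cinner x y"
  by (metis cinner_commute cinner_scaleC_left complex_cnj_mult)

lemma cinner_scaleR_left: "cinner (r *\<^sub>R x) y = of_real r * cinner x y"
  by (simp add: scaleR_scaleC cinner_scaleC_left)

lemma cinner_scaleR_right: "cinner x (r *\<^sub>R y) = of_real r * cinner x y"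
  by (simp add: scaleR_scaleC cinner_scaleC_right)

lemma cinner_zero_left [simp]: "cinner 0 y = 0"
  using cinner_scaleR_left[of 0 0 y] by simp

lemma cinner_zero_right [simp]: "cinner x 0 = 0"
  using cinner_scaleR_right[of x 0 0] by simp

lemma cinner_diff_left: "cinner (x - y) z = cinner x z - cinner y z"
  using cinner_add_left[of "x - y" y z] by simp

lemma cinner_sum_left: "cinner (sum f S) y = (\<Sum>i\<in>S. cinner (f i) y)"
  by (induction S rule: infinite_finite_induct) (simp_all add: cinner_add_left)

lemma cinner_sum_right: "cinner x (sum f S) = (\<Sum>i\<in>S. cinner x (f i))"
  by (induction S rule: infinite_finite_induct) (simp_all add: cinner_add_right)

lemma scaleC_zero_right [simp]: "c *\<^sub>C 0 = (0::'a::complex_vector)"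
  by (rule complex_vector.scale_zero_right)

lemma scaleC_zero_left [simp]: "0 *\<^sub>C x = (0::'a::complex_vector)"
  by (rule complex_vector.scale_zero_left)

lemma scaleC_sum_right: "c *\<^sub>C sum f S = (\<Sum>i\<in>S. c *\<^sub>C f i)"
  by (rule complex_vector.scale_sum_right)

lemma scaleC_diff_right: "c *\<^sub>C (x - y) = c *\<^sub>C x - c *\<^sub>C (y::'a::complex_vector)"
  by (rule complex_vector.scale_right_diff_distrib)

lemma scaleC_scaleR: "c *\<^sub>C (r *\<^sub>R x) = r *\<^sub>R (c *\<^sub>C x)"
  by (simp add: scaleR_scaleC scaleC_scaleC mult.commute)

lemma cinner_self_Re: "Re (cinner x x) = (norm x)\<^sup>2"
proof -
  have "0 \<le> Re (cinner x x)"
    using norm_ge_zero[of x] by (simp add: norm_eq_sqrt_cinner)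
  then show ?thesis
    by (simp add: norm_eq_sqrt_cinner)
qed

lemma cinner_self: "cinner x x = of_real ((norm x)\<^sup>2)"
proof -
  have "Im (cinner x x) = 0"
    using cinner_commute[of x x] by (metis Reals_cnj_iff complex_is_Real_iff)
  then show ?thesis
    by (simp add: complex_eq_iff cinner_self_Re)
qed

lemma norm_scaleC: "norm (c *\<^sub>C x) = cmod c * norm (x::'a::complex_inner)"
proof -
  have "of_real ((norm (c *\<^sub>C x))\<^sup>2) = c * cnj c * of_real ((norm x)\<^sup>2)"
    unfolding cinner_self[symmetric] cinner_scaleC_left cinner_scaleC_right by simp
  also have "\<dots> = of_real ((cmod c * norm x)\<^sup>2)"
    unfolding complex_norm_square[symmetric] power_mult_distrib by simp
  finally have "of_real ((norm (c *\<^sub>C x))\<^sup>2) = (of_real ((cmod c * norm x)\<^sup>2) :: complex)" .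
  then have "(norm (c *\<^sub>C x))\<^sup>2 = (cmod c * norm x)\<^sup>2"
    using of_real_eq_iff by blast
  then show ?thesis
    by (simp add: power2_eq_iff_nonneg)
qed

lemma norm_add_square: "(norm (x + y))\<^sup>2 = (norm x)\<^sup>2 + (norm y)\<^sup>2 + 2 * Re (cinner x y)"
proof -
  have "Re (cinner y x) = Re (cinner x y)"
    by (metis cinner_commute complex_cnj cnj.simps(1))
  then show ?thesis
    by (simp add: cinner_add_left cinner_add_right flip: cinner_self_Re)
qed

lemma norm_diff_square: "(norm (x - y))\<^sup>2 = (norm x)\<^sup>2 + (norm y)\<^sup>2 - 2 * Re (cinner x y)"
  using norm_add_square[of "x - y" y] by (simp add: cinner_diff_left cinner_self_Re)

text \<open>The triangle inequality for the norm, which the axioms provide, is equivalent to the real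
  part of the Cauchy--Schwarz inequality; a rotation of \<open>x\<close> gives the modulus.\<close>

lemma cauchy_schwarz: "cmod (cinner x y) \<le> norm x * norm (y::'a::complex_inner)"
proof -
  define c where "c = (if cinner x y = 0 then 1 else cnj (sgn (cinner x y)))"
  have c: "cmod c = 1"
    by (simp add: c_def norm_sgn)
  have "Re (c * cinner x y) = cmod (cinner x y)"
  proof (cases "cinner x y = 0")
    case False
    have "cnj (sgn (cinner x y)) * cinner x y = of_real (cmod (cinner x y))"
      using False
      by (simp add: sgn_eq complex_norm_square[symmetric] mult.commute[of "cnj _"] power2_eq_square)
    then show ?thesis
      using False by (simp add: c_def)
  qed (simp add: c_def)
  moreover have "(norm (c *\<^sub>C x + y))\<^sup>2 \<le> (norm x + norm y)\<^sup>2"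
    using norm_triangle_ineq[of "c *\<^sub>C x" y] by (simp add: norm_scaleC c)
  ultimately show ?thesis
    by (simp add: norm_add_square norm_scaleC c cinner_scaleC_left power2_sum)
qed

lemma bounded_linear_cinner_left: "bounded_linear (\<lambda>x. cinner x y)"
  by (rule bounded_linear_intro[where K = "norm y"])
    (simp_all add: cinner_add_left cinner_scaleR_left scaleR_conv_of_real cauchy_schwarz)

lemma cinner_eqI:
  assumes "\<And>y. cinner x y = cinner x' y"
  shows "x = x'"
proof -
  have "cinner (x - x') (x - x') = 0"
    by (simp add: cinner_diff_left assms)
  then show ?thesis
    by (simp add: cinner_self)
qed


section \<open>Finite orthonormal families\<close>

definition orthonormal :: "'i set \<Rightarrow> ('i \<Rightarrow> 'a::complex_inner) \<Rightarrow> bool"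
  where "orthonormal S e \<longleftrightarrow> (\<forall>i\<in>S. \<forall>j\<in>S. cinner (e i) (e j) = of_bool (i = j))"

lemma orthonormal_mono: "orthonormal S e \<Longrightarrow> R \<subseteq> S \<Longrightarrow> orthonormal R e"
  unfolding orthonormal_def by blast

lemma orthonormal_coefficient:
  assumes "orthonormal S e" "finite S" "j \<in> S"
  shows "cinner (\<Sum>i\<in>S. c i *\<^sub>C e i) (e j) = c j"
proof -
  have "cinner (\<Sum>i\<in>S. c i *\<^sub>C e i) (e j) = (\<Sum>i\<in>S. c i * of_bool (i = j))"
    using assms by (auto simp: cinner_sum_left cinner_scaleC_left orthonormal_def intro!: sum.cong)
  also have "\<dots> = c j"
    using assms by (simp add: of_bool_def if_distrib cong: if_cong)
  finally show ?thesis .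
qed

lemma orthonormal_residual:
  assumes "orthonormal S e" "finite S" "j \<in> S"
  shows "cinner (x - (\<Sum>i\<in>S. cinner x (e i) *\<^sub>C e i)) (e j) = 0"
  by (simp add: cinner_diff_left orthonormal_coefficient[OF assms])

lemma bessel_inequality:
  assumes "orthonormal S e" "finite S"
  shows "norm (\<Sum>i\<in>S. cinner x (e i) *\<^sub>C e i) \<le> norm x"
proof -
  define p where "p = (\<Sum>i\<in>S. cinner x (e i) *\<^sub>C e i)"
  have "cinner (x - p) p = 0"
    unfolding p_def cinner_sum_right cinner_scaleC_right
    by (simp add: orthonormal_residual[OF assms])
  then have "(norm x)\<^sup>2 = (norm (x - p))\<^sup>2 + (norm p)\<^sup>2"
    using norm_add_square[of "x - p" p] by simp
  then have "(norm p)\<^sup>2 \<le> (norm x)\<^sup>2"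
    by simp
  then show ?thesis
    unfolding p_def by (simp add: power2_le_iff_abs_le)
qed

text \<open>One step of the Gram--Schmidt process: the normalised residual of \<open>x\<close> is adjoined unless it
  is zero.\<close>

lemma orthonormal_extend:
  fixes x :: "'a::complex_inner"
  assumes B: "orthonormal B (\<lambda>b. b)" "finite B"
  obtains B' c where "B \<subseteq> B'" "finite B'" "orthonormal B' (\<lambda>b. b)" "x = (\<Sum>b\<in>B'. c b *\<^sub>C b)"
proof -
  define r where "r = x - (\<Sum>b\<in>B. cinner x b *\<^sub>C b)"
  have r_orth: "cinner r b = 0" if "b \<in> B" for b
    using orthonormal_residual[OF B that] by (simp add: r_def)
  show thesis
  proof (cases "r = 0")
    case True
    then show thesis
      using that[of B "\<lambda>b. cinner x b"] B by (simp add: r_def)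
  next
    case False
    define q where "q = (1 / norm r) *\<^sub>R r"
    have q: "cinner q q = 1"
      using False by (simp add: q_def cinner_scaleR_left cinner_scaleR_right cinner_self power2_eq_square)
    have q_orth: "cinner q b = 0" if "b \<in> B" for b
      using r_orth[OF that] by (simp add: q_def cinner_scaleR_left)
    then have q_orth': "cinner b q = 0" if "b \<in> B" for b
      using that by (metis cinner_commute complex_cnj_zero)
    have "q \<notin> B"
      using q q_orth by force
    have "orthonormal (insert q B) (\<lambda>b. b)"
      using B(1) q q_orth q_orth' \<open>q \<notin> B\<close> by (auto simp: orthonormal_def)
    have "r = of_real (norm r) *\<^sub>C q"
      using False by (simp add: q_def flip: scaleR_scaleC)
    moreover have "(\<Sum>b\<in>B. (if b = q then of_real (norm r) else cinner x b) *\<^sub>C b)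
        = (\<Sum>b\<in>B. cinner x b *\<^sub>C b)"
      using \<open>q \<notin> B\<close> by (intro sum.cong) auto
    ultimately have "x = (\<Sum>b\<in>insert q B. (if b = q then of_real (norm r) else cinner x b) *\<^sub>C b)"
      using B(2) \<open>q \<notin> B\<close> r_def by simp
    then show thesis
      using \<open>orthonormal (insert q B) (\<lambda>b. b)\<close> B(2)
      by (intro that[of "insert q B" "\<lambda>b. if b = q then of_real (norm r) else cinner x b"]) auto
  qed
qed

text \<open>In infinite dimension a finite orthonormal set does not span, so the Gram--Schmidt step with a
  vector outside its span enlarges it.\<close>

lemma orthonormal_family_exists:
  fixes V :: "'i set"
  assumes inf: "\<not> (\<exists>B :: 'a::complex_inner set. finite B \<and> cspan B = UNIV)"
    and fin: "finite V"
  obtains e :: "'i \<Rightarrow> 'a::complex_inner" where "orthonormal V e"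
proof -
  have "\<exists>B :: 'a set. finite B \<and> orthonormal B (\<lambda>b. b) \<and> n \<le> card B" for n
  proof (induction n)
    case 0
    show ?case
      by (rule exI[of _ "{}"]) (simp add: orthonormal_def)
  next
    case (Suc n)
    then obtain B :: "'a set" where B: "finite B" "orthonormal B (\<lambda>b. b)" "n \<le> card B"
      by blast
    have "cspan B \<noteq> UNIV"
      using inf B(1) by blast
    then obtain x where x: "x \<notin> cspan B"
      by blast
    obtain B' c where B': "B \<subseteq> B'" "finite B'" "orthonormal B' (\<lambda>b. b)" "x = (\<Sum>b\<in>B'. c b *\<^sub>C b)"
      using orthonormal_extend[OF B(2,1), of x] by blast
    have "x \<in> cspan B'"
      unfolding B'(4)
      by (intro complex_vector.span_sum complex_vector.span_scale complex_vector.span_base)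
    then have "B \<noteq> B'"
      using x by blast
    then have "card B < card B'"
      using B' by (simp add: psubset_card_mono psubset_eq)
    then show ?case
      using B' B(3) by (intro exI[of _ B']) simp
  qed
  from this[of "card V"] obtain B :: "'a set"
    where B: "finite B" "orthonormal B (\<lambda>b. b)" "card V \<le> card B"
    by blast
  obtain e :: "'i \<Rightarrow> 'a" where "e ` V \<subseteq> B" "inj_on e V"
    using card_le_inj[OF fin B(1,3)] by blast
  then have "cinner (e i) (e j) = of_bool (i = j)" if "i \<in> V" "j \<in> V" for i j
    using B(2) that inj_on_eq_iff[of e V i j] by (simp add: orthonormal_def image_subset_iff)
  then have "orthonormal V e"
    by (simp add: orthonormal_def)
  then show thesis
    using that by blast
qed


section \<open>Adjoints and row operators\<close>

text \<open>The representing vector minimises \<open>q x = \<parallel>x\<parallel>\<^sup>2 - 2 Re (f x)\<close>: a minimising sequence is Cauchy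
  because \<open>\<parallel>x - y\<parallel>\<^sup>2 = 2 q x + 2 q y - 4 q ((x + y) / 2)\<close>, and at a minimum the derivative of
  \<open>q\<close> vanishes in every direction.\<close>

theorem riesz_representation:
  fixes f :: "'a::chilbert_space \<Rightarrow>\<^sub>L complex"
  assumes f: "f \<in> cblin"
  obtains z where "\<And>x. f x = cinner x z"
proof -
  define q where "q x = (norm x)\<^sup>2 - 2 * Re (f x)" for x
  have lower: "- (norm f)\<^sup>2 \<le> q x" for x
  proof -
    have "Re (f x) \<le> norm f * norm x"
      using norm_blinfun[of f x] complex_Re_le_cmod order_trans by blast
    moreover have "2 * norm f * norm x \<le> (norm f)\<^sup>2 + (norm x)\<^sup>2"
      by (rule sum_squares_bound)
    ultimately show ?thesis
      unfolding q_def by linarith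
  qed
  have bdd: "bdd_below (range q)"
    using lower by (intro bdd_belowI[of _ "- (norm f)\<^sup>2"]) auto
  define m where "m = Inf (range q)"
  have m_le: "m \<le> q x" for x
    unfolding m_def by (intro cInf_lower bdd) simp
  have "\<exists>x. q x < m + inverse (real (Suc n))" for n
  proof -
    have "Inf (range q) < m + inverse (real (Suc n))"
      by (simp add: m_def)
    then show ?thesis
      by (subst (asm) cInf_less_iff) (auto simp: bdd)
  qed
  then obtain s where s: "q (s n) < m + inverse (real (Suc n))" for n
    by metis
  have midpoint: "(norm (x - y))\<^sup>2 = 2 * q x + 2 * q y - 4 * q ((1/2) *\<^sub>R (x + y))" for x y
    by (simp add: q_def norm_diff_square norm_add_square blinfun.scaleR_right blinfun.add_right
        power_divide cinner_scaleR_left cinner_scaleR_right algebra_simps)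
  have close: "(norm (s i - s j))\<^sup>2 \<le> 4 * inverse (real (Suc n))" if "n \<le> i" "n \<le> j" for i j n
  proof -
    have "inverse (real (Suc i)) \<le> inverse (real (Suc n))" "inverse (real (Suc j)) \<le> inverse (real (Suc n))"
      using that by (simp_all add: le_imp_inverse_le)
    then show ?thesis
      using s[of i] s[of j] m_le[of "(1/2) *\<^sub>R (s i + s j)"] midpoint[of "s i" "s j"] by linarith
  qed
  have "Cauchy s"
  proof (rule metric_CauchyI)
    fix d :: real
    assume "0 < d"
    then obtain n where n: "inverse (real (Suc n)) < d\<^sup>2 / 4"
      using reals_Archimedean[of "d\<^sup>2 / 4"] by auto
    have "dist (s i) (s j) < d" if "n \<le> i" "n \<le> j" for i j
    proof -
      have "(norm (s i - s j))\<^sup>2 < d\<^sup>2"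
        using close[OF that] n by linarith
      then show ?thesis
        using \<open>0 < d\<close> by (simp add: dist_norm power_less_imp_less_base)
    qed
    then show "\<exists>M. \<forall>i\<ge>M. \<forall>j\<ge>M. dist (s i) (s j) < d"
      by blast
  qed
  then obtain z where z: "s \<longlonglongrightarrow> z"
    using Cauchy_convergent convergent_def by blast
  have "(\<lambda>n. q (s n)) \<longlonglongrightarrow> q z"
    unfolding q_def by (intro tendsto_intros z blinfun.tendsto)
  moreover have "(\<lambda>n. m + inverse (real (Suc n))) \<longlonglongrightarrow> m + 0"
    by (intro tendsto_intros LIMSEQ_inverse_real_of_nat)
  ultimately have "q z \<le> m + 0"
    using s by (intro LIMSEQ_le) (auto intro: less_imp_le)
  then have min: "q z \<le> q x" for x
    using m_le[of x] by simp
  have real_part: "Re (f y) = Re (cinner y z)" for y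
  proof -
    define d where "d = Re (cinner z y) - Re (f y)"
    have pos: "0 \<le> t\<^sup>2 * (norm y)\<^sup>2 + 2 * t * d" for t
      using min[of "z + t *\<^sub>R y"]
      by (simp add: q_def d_def norm_add_square blinfun.add_right blinfun.scaleR_right
          cinner_scaleR_right power_mult_distrib algebra_simps)
    \<comment> \<open>The quadratic in \<open>t\<close> is nonnegative only if its linear coefficient vanishes; the test
      value is its minimiser, with \<open>1\<close> added to the leading coefficient to avoid a division by zero.\<close>
    have "0 \<le> (d / ((norm y)\<^sup>2 + 1))\<^sup>2 * (norm y)\<^sup>2 - 2 * (d / ((norm y)\<^sup>2 + 1)) * d"
      using pos[of "- (d / ((norm y)\<^sup>2 + 1))"] by simp
    also have "\<dots> = - (d / ((norm y)\<^sup>2 + 1))\<^sup>2 * ((norm y)\<^sup>2 + 2)"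
    proof -
      define N where "N = (norm y)\<^sup>2 + 1"
      have "N \<noteq> 0"
        using zero_le_power2[of "norm y"] unfolding N_def by linarith
      then have "(d / N)\<^sup>2 * (N - 1) - 2 * (d / N) * d = - (d / N)\<^sup>2 * (N + 1)"
        by (simp add: power2_eq_square field_simps)
      then show ?thesis
        by (simp add: N_def)
    qed
    finally have "(d / ((norm y)\<^sup>2 + 1))\<^sup>2 * ((norm y)\<^sup>2 + 2) \<le> 0"
      by simp
    moreover have "0 < (norm y)\<^sup>2 + 2" "(norm y)\<^sup>2 + 1 \<noteq> 0"
      using zero_le_power2[of "norm y"] by linarith+
    ultimately have "d = 0"
      by (simp add: mult_le_0_iff)
    then show ?thesis
      using cinner_commute[of z y] by (simp add: d_def)
  qed
  have "f y = cinner y z" for y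
  proof -
    have "f (\<i> *\<^sub>C y) = \<i> * f y"
      using f by (simp add: cblin_def scaleC_complex_def)
    then have "Im (f y) = Im (cinner y z)"
      using real_part[of "\<i> *\<^sub>C y"] by (simp add: cinner_scaleC_left)
    then show ?thesis
      using real_part by (simp add: complex_eq_iff)
  qed
  then show thesis
    using that by blast
qed

lemma adj_eqI:
  fixes T :: "'a::chilbert_space \<Rightarrow>\<^sub>L 'b::chilbert_space"
  assumes "\<And>x y. cinner (T x) y = cinner x (blinfun_apply S y)"
  shows "adj T = S"
  unfolding adj_def
proof (rule the_equality)
  fix S' :: "'b \<Rightarrow>\<^sub>L 'a"
  assume *: "\<forall>x y. cinner (T x) y = cinner x (blinfun_apply S' y)"
  show "S' = S"
  proof (rule blinfun_eqI, rule cinner_eqI)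
    fix y x
    show "cinner (S' y) x = cinner (S y) x"
      by (metis * assms cinner_commute)
  qed
qed (use assms in auto)

lemma cinner_adj:
  fixes T :: "'a::chilbert_space \<Rightarrow>\<^sub>L 'b::chilbert_space"
  assumes T: "T \<in> cblin"
  shows "cinner (T x) y = cinner x (adj T y)"
proof -
  have "\<exists>z. \<forall>x. cinner (T x) y = cinner x z" for y
  proof -
    have bl: "bounded_linear (\<lambda>x. cinner (T x) y)"
      by (intro bounded_linear_compose[OF bounded_linear_cinner_left] blinfun.bounded_linear_right)
    then have "Blinfun (\<lambda>x. cinner (T x) y) \<in> cblin"
      using T by (simp add: cblin_def bounded_linear_Blinfun_apply cinner_scaleC_left scaleC_complex_def)
    from riesz_representation[OF this] show ?thesis
      by (metis bounded_linear_Blinfun_apply[OF bl])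
  qed
  then obtain g where g: "cinner (T x) y = cinner x (g y)" for x y
    by metis
  have "bounded_linear g"
  proof (rule bounded_linear_intro[where K = "norm T"])
    show "g (y + y') = g y + g y'" for y y'
    proof (rule cinner_eqI)
      fix x
      show "cinner (g (y + y')) x = cinner (g y + g y') x"
        by (metis g cinner_commute cinner_add_right)
    qed
    show "g (r *\<^sub>R y) = r *\<^sub>R g y" for r y
    proof (rule cinner_eqI)
      fix x
      show "cinner (g (r *\<^sub>R y)) x = cinner (r *\<^sub>R g y) x"
        by (metis g cinner_commute cinner_scaleR_right)
    qed
    show "norm (g y) \<le> norm y * norm T" for y
    proof -
      have "(norm (g y))\<^sup>2 = cmod (cinner (T (g y)) y)"
        by (simp add: g cinner_self norm_power)
      also have "\<dots> \<le> norm (T (g y)) * norm y"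
        by (rule cauchy_schwarz)
      also have "\<dots> \<le> norm T * norm (g y) * norm y"
        by (intro mult_right_mono norm_blinfun) simp
      finally have "norm (g y) * norm (g y) \<le> norm (g y) * (norm y * norm T)"
        by (simp add: power2_eq_square mult_ac)
      then show ?thesis
        by (cases "norm (g y) = 0") (auto simp: mult_le_cancel_left)
    qed
  qed
  then have "adj T = Blinfun g"
    by (intro adj_eqI) (simp add: g bounded_linear_Blinfun_apply)
  then show ?thesis
    using \<open>bounded_linear g\<close> by (simp add: g bounded_linear_Blinfun_apply)
qed

lemma row_norm_eq:
  assumes "has_row_square X G"
  shows "row_norm X = sqrt (norm G)"
proof -
  have "(THE G. has_row_square X G) = G"
    using assms unfolding has_row_square_def
    by (intro the_equality blinfun_eqI) (auto intro: has_sum_unique)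
  then show ?thesis
    by (simp add: row_norm_def)
qed

text \<open>The column of adjoints is bounded because \<open>\<Sum> \<parallel>X\<^sub>i\<^sup>* h\<parallel>\<^sup>2 = \<langle>G h, h\<rangle>\<close>, and the row is bounded
  by duality with the column.\<close>

lemma row_upper_estimate:
  fixes X :: "'n::countable \<Rightarrow> 'h::chilbert_space \<Rightarrow>\<^sub>L 'h"
  assumes X: "X \<in> row_tuples" and r: "row_norm X \<le> r" and I: "finite I"
  shows "(norm (\<Sum>i\<in>I. X i (y i)))\<^sup>2 \<le> r\<^sup>2 * (\<Sum>i\<in>I. (norm (y i))\<^sup>2)"
proof -
  obtain G where G: "has_row_square X G"
    using X by (auto simp: row_tuples_def)
  have Xc: "X i \<in> cblin" for i
    using X by (simp add: row_tuples_def)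
  have r0: "0 \<le> r"
    using r row_norm_eq[OF G] order_trans[OF real_sqrt_ge_zero[OF norm_ge_zero]] by metis
  have normG: "norm G \<le> r\<^sup>2"
    using r r0 by (simp add: row_norm_eq[OF G] real_sqrt_le_iff' real_le_lsqrt sqrt_le_D)
  have column: "(\<Sum>i\<in>I. (norm (adj (X i) h))\<^sup>2) \<le> r\<^sup>2 * (norm h)\<^sup>2" for h
  proof -
    have "((\<lambda>i. cinner ((X i o\<^sub>L adj (X i)) h) h) has_sum cinner (G h) h) UNIV"
      using has_sum_bounded_linear[OF bounded_linear_cinner_left] G
      unfolding has_row_square_def by blast
    then have "((\<lambda>i. Re (cinner ((X i o\<^sub>L adj (X i)) h) h)) has_sum Re (cinner (G h) h)) UNIV"
      by (rule has_sum_Re)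
    then have "((\<lambda>i. (norm (adj (X i) h))\<^sup>2) has_sum Re (cinner (G h) h)) UNIV"
      by (simp add: cinner_adj[OF Xc] cinner_self)
    then have "(\<Sum>i\<in>I. (norm (adj (X i) h))\<^sup>2) \<le> Re (cinner (G h) h)"
      by (rule finite_sum_le_has_sum) (use I in auto)
    also have "\<dots> \<le> norm (G h) * norm h"
      using complex_Re_le_cmod cauchy_schwarz order_trans by blast
    also have "\<dots> \<le> norm G * norm h * norm h"
      by (intro mult_right_mono norm_blinfun) simp
    also have "\<dots> \<le> r\<^sup>2 * (norm h)\<^sup>2"
      using mult_right_mono[OF normG, of "(norm h)\<^sup>2"] by (simp add: power2_eq_square mult_ac)
    finally show ?thesis .
  qed
  define h where "h = (\<Sum>i\<in>I. X i (y i))"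
  have "(norm h)\<^sup>2 = Re (\<Sum>i\<in>I. cinner (y i) (adj (X i) h))"
    unfolding cinner_self_Re[symmetric] by (subst h_def) (simp add: cinner_sum_left cinner_adj[OF Xc])
  also have "\<dots> \<le> (\<Sum>i\<in>I. \<bar>norm (y i)\<bar> * \<bar>norm (adj (X i) h)\<bar>)"
    unfolding Re_sum
    by (intro sum_mono) (simp add: order_trans[OF complex_Re_le_cmod cauchy_schwarz])
  also have "\<dots> \<le> L2_set (\<lambda>i. norm (y i)) I * L2_set (\<lambda>i. norm (adj (X i) h)) I"
    by (rule L2_set_mult_ineq)
  also have "\<dots> \<le> L2_set (\<lambda>i. norm (y i)) I * (r * norm h)"
    unfolding L2_set_def[of "\<lambda>i. norm (adj (X i) h)"]
    using column[of h] r0 by (intro mult_left_mono real_le_lsqrt) (auto simp: power_mult_distrib)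
  finally have "norm h * norm h \<le> norm h * (r * L2_set (\<lambda>i. norm (y i)) I)"
    by (simp add: power2_eq_square mult_ac)
  then have "norm h \<le> r * L2_set (\<lambda>i. norm (y i)) I"
    using r0 by (cases "norm h = 0") (auto simp: mult_le_cancel_left)
  then have "(norm h)\<^sup>2 \<le> (r * L2_set (\<lambda>i. norm (y i)) I)\<^sup>2"
    by (intro power_mono) auto
  then show ?thesis
    by (simp add: h_def power_mult_distrib L2_set_def sum_nonneg)
qed

text \<open>On finitely supported families the infinite sums in the definition reduce to finite ones.\<close>

lemma row_lower_estimate:
  fixes X :: "'n::countable \<Rightarrow> 'h::chilbert_space \<Rightarrow>\<^sub>L 'h"
  assumes "row_bounded_below X"
  obtains C where "C > 0"
    "\<And>I y. finite I \<Longrightarrow> C\<^sup>2 * (\<Sum>i\<in>I. (norm (y i))\<^sup>2) \<le> (norm (\<Sum>i\<in>I. X i (y i)))\<^sup>2"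
proof -
  obtain C where C: "C > 0" and lower: "\<And>y. (\<lambda>i. (norm (y i))\<^sup>2) summable_on UNIV \<Longrightarrow>
       norm (\<Sum>\<^sub>\<infinity>i. X i (y i)) \<ge> C * sqrt (\<Sum>\<^sub>\<infinity>i. (norm (y i))\<^sup>2)"
    using assms unfolding row_bounded_below_def by blast
  have "C\<^sup>2 * (\<Sum>i\<in>I. (norm (y i))\<^sup>2) \<le> (norm (\<Sum>i\<in>I. X i (y i)))\<^sup>2" if I: "finite I" for I y
  proof -
    define y' where "y' i = (if i \<in> I then y i else 0)" for i
    have 1: "((\<lambda>i. (norm (y' i))\<^sup>2) has_sum (\<Sum>i\<in>I. (norm (y i))\<^sup>2)) UNIV"
      using has_sum_finite[OF I, of "\<lambda>i. (norm (y i))\<^sup>2"]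
      by (subst has_sum_cong_neutral[where T = I and g = "\<lambda>i. (norm (y i))\<^sup>2"]) (auto simp: y'_def)
    have 2: "((\<lambda>i. X i (y' i)) has_sum (\<Sum>i\<in>I. X i (y i))) UNIV"
      using has_sum_finite[OF I, of "\<lambda>i. X i (y i)"]
      by (subst has_sum_cong_neutral[where T = I and g = "\<lambda>i. X i (y i)"])
        (auto simp: y'_def blinfun.zero_right)
    have "C * sqrt (\<Sum>i\<in>I. (norm (y i))\<^sup>2) \<le> norm (\<Sum>i\<in>I. X i (y i))"
      using lower[OF has_sum_imp_summable[OF 1]] infsumI[OF 1] infsumI[OF 2] by simp
    then have "(C * sqrt (\<Sum>i\<in>I. (norm (y i))\<^sup>2))\<^sup>2 \<le> (norm (\<Sum>i\<in>I. X i (y i)))\<^sup>2"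
      using C by (intro power_mono) (auto simp: sum_nonneg)
    then show ?thesis
      by (simp add: power_mult_distrib sum_nonneg)
  qed
  then show thesis
    using that C by blast
qed


section \<open>Tensor products of operators\<close>

text \<open>The two factors play symmetric roles, so a statement about operators \<open>K \<otimes> 1\<close> also covers the
  operators \<open>1 \<otimes> A\<close>.\<close>

lemma hilbert_tensor_flip: "hilbert_tensor ten \<Longrightarrow> hilbert_tensor (\<lambda>e h. ten h e)"
proof -
  have "{ten h e |e h. True} = {ten h e |h e. True}"
    by blast
  then show "hilbert_tensor ten \<Longrightarrow> hilbert_tensor (\<lambda>e h. ten h e)"
    unfolding hilbert_tensor_def by (simp add: mult.commute)
qed

context
  fixes ten :: "'h::chilbert_space \<Rightarrow> 'e::chilbert_space \<Rightarrow> 't::chilbert_space"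
  assumes tensor: "hilbert_tensor ten"
begin

lemma ten_add_left: "ten (h + h') e = ten h e + ten h' e"
  and ten_add_right: "ten h (e + e') = ten h e + ten h e'"
  and ten_scaleC_left: "ten (c *\<^sub>C h) e = c *\<^sub>C ten h e"
  and ten_scaleC_right: "ten h (c *\<^sub>C e) = c *\<^sub>C ten h e"
  and cinner_ten: "cinner (ten h e) (ten h' e') = cinner h h' * cinner e e'"
  and closure_elementary_tensors: "closure (cspan {ten h e |h e. True}) = UNIV"
  using tensor unfolding hilbert_tensor_def by blast+

lemma ten_zero_left [simp]: "ten 0 e = 0"
  using ten_scaleC_left[of 0 0 e] by simp

lemma ten_zero_right [simp]: "ten h 0 = 0"
  using ten_scaleC_right[of h 0 0] by simp

lemma ten_sum_left: "ten (sum f S) e = (\<Sum>i\<in>S. ten (f i) e)"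
  by (induction S rule: infinite_finite_induct) (simp_all add: ten_add_left)

lemma ten_sum_right: "ten h (sum f S) = (\<Sum>i\<in>S. ten h (f i))"
  by (induction S rule: infinite_finite_induct) (simp_all add: ten_add_right)

lemma norm_ten: "norm (ten h e) = norm h * norm e"
proof -
  have "(norm (ten h e))\<^sup>2 = (norm h * norm e)\<^sup>2"
    unfolding cinner_self_Re[symmetric] cinner_ten
    by (simp add: cinner_self power_mult_distrib flip: of_real_power of_real_mult)
  then show ?thesis
    by (simp add: power2_eq_iff_nonneg)
qed

text \<open>A finite sum of elementary tensors is a sum of slices \<open>f b \<otimes> b\<close> along a finite orthonormal set
  of vectors \<open>b\<close>. Along such a set the tensor product is an orthogonal sum of copies of \<^typ>\<open>'h\<close>, so
  estimates for operators on \<^typ>\<open>'h\<close> can be applied slice by slice.\<close>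

lemma norm_slices:
  assumes B: "finite B" "orthonormal B e"
  shows "(norm (\<Sum>b\<in>B. ten (f b) (e b)))\<^sup>2 = (\<Sum>b\<in>B. (norm (f b))\<^sup>2)"
proof -
  have "cinner (\<Sum>b\<in>B. ten (f b) (e b)) (\<Sum>b\<in>B. ten (f b) (e b))
      = (\<Sum>b\<in>B. \<Sum>b'\<in>B. if b' = b then cinner (f b) (f b) else 0)"
    using B(2)
    by (auto simp: cinner_sum_right cinner_sum_left cinner_ten orthonormal_def intro!: sum.cong)
  also have "\<dots> = of_real (\<Sum>b\<in>B. (norm (f b))\<^sup>2)"
    using B(1) by (simp add: cinner_self)
  finally show ?thesis
    by (metis cinner_self of_real_eq_iff)
qed

lemma slices_mono:
  assumes "finite B'" "B \<subseteq> B'" "u = (\<Sum>b\<in>B. ten (f b) b)"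
  shows "\<exists>f'. u = (\<Sum>b\<in>B'. ten (f' b) b)"
proof -
  have "u = (\<Sum>b\<in>B'. ten (if b \<in> B then f b else 0) b)"
    unfolding assms(3) by (rule sum.mono_neutral_cong_left) (use assms in auto)
  then show ?thesis
    by (rule exI[of _ "\<lambda>b. if b \<in> B then f b else 0"])
qed

text \<open>The slicing set can be chosen to contain a given one: adding an elementary tensor \<open>h \<otimes> e\<close> only
  requires room for \<open>e\<close>. This makes it possible to slice several tensors along the same set.\<close>

lemma slices_exist:
  assumes "u \<in> cspan {ten h e |h e. True}" "finite B\<^sub>0" "orthonormal B\<^sub>0 (\<lambda>b. b)"
  shows "\<exists>B f. B\<^sub>0 \<subseteq> B \<and> finite B \<and> orthonormal B (\<lambda>b. b) \<and> u = (\<Sum>b\<in>B. ten (f b) b)"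
  using assms(1)
proof (induction rule: complex_vector.span_induct_alt)
  case base
  show ?case
    using assms(2,3) by (intro exI[of _ B\<^sub>0] exI[of _ "\<lambda>_. 0"]) simp
next
  case (step c x y)
  then obtain B f where B: "B\<^sub>0 \<subseteq> B" "finite B" "orthonormal B (\<lambda>b. b)"
    and y: "y = (\<Sum>b\<in>B. ten (f b) b)"
    by blast
  obtain h e where x: "x = ten h e"
    using step by blast
  obtain B' d where B': "B \<subseteq> B'" "finite B'" "orthonormal B' (\<lambda>b. b)"
    and e: "e = (\<Sum>b\<in>B'. d b *\<^sub>C b)"
    using orthonormal_extend[OF B(3,2), of e] by blast
  obtain f' where y': "y = (\<Sum>b\<in>B'. ten (f' b) b)"
    using slices_mono[OF B'(2,1) y] by blast
  have "c *\<^sub>C x + y = (\<Sum>b\<in>B'. ten ((c * d b) *\<^sub>C h + f' b) b)"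
    unfolding x y' e
    by (simp add: ten_sum_right ten_scaleC_right ten_scaleC_left ten_add_left scaleC_sum_right
        scaleC_scaleC sum.distrib)
  then show ?case
    using B(1) B' by (intro exI[of _ B'] exI[of _ "\<lambda>b. (c * d b) *\<^sub>C h + f' b"]) auto
qed

lemma common_slices_exist:
  assumes "finite I" "\<And>i. i \<in> I \<Longrightarrow> u i \<in> cspan {ten h e |h e. True}"
  shows "\<exists>B f. finite B \<and> orthonormal B (\<lambda>b. b) \<and> (\<forall>i\<in>I. u i = (\<Sum>b\<in>B. ten (f i b) b))"
proof -
  have "\<exists>B. finite B \<and> orthonormal B (\<lambda>b. b) \<and> (\<forall>i\<in>I. \<exists>f. u i = (\<Sum>b\<in>B. ten (f b) b))"
    using assms
  proof (induction I rule: finite_induct)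
    case empty
    show ?case
      by (rule exI[of _ "{}"]) (simp add: orthonormal_def)
  next
    case (insert j J)
    then obtain B where B: "finite B" "orthonormal B (\<lambda>b. b)"
      and J: "\<forall>i\<in>J. \<exists>f. u i = (\<Sum>b\<in>B. ten (f b) b)"
      by auto
    obtain B' f where B': "B \<subseteq> B'" "finite B'" "orthonormal B' (\<lambda>b. b)"
      and j: "u j = (\<Sum>b\<in>B'. ten (f b) b)"
      using slices_exist[OF insert.prems[of j] B] by auto
    have "\<exists>f. u i = (\<Sum>b\<in>B'. ten (f b) b)" if "i \<in> insert j J" for i
      using that j J slices_mono[OF B'(2,1)] by blast
    then show ?case
      using B'(2,3) by blast
  qed
  then show ?thesis
    by metis
qed

lemma elementary_tensors_approximate:
  shows "\<exists>s. (\<forall>n::nat. s n \<in> cspan {ten h e |h e. True}) \<and> s \<longlonglongrightarrow> u"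
proof -
  have "u \<in> closure (cspan {ten h e |h e. True})"
    unfolding closure_elementary_tensors by (rule UNIV_I)
  then show ?thesis
    by (simp only: closure_sequential)
qed

lemma tensor_blinfun_eqI:
  fixes T T' :: "'t \<Rightarrow>\<^sub>L 's::complex_inner"
  assumes T: "T \<in> cblin" "T' \<in> cblin" and eq: "\<And>h e. T (ten h e) = T' (ten h e)"
  shows "T = T'"
proof (rule blinfun_eqI)
  fix u
  obtain s where s: "\<And>n::nat. s n \<in> cspan {ten h e |h e. True}" "s \<longlonglongrightarrow> u"
    using elementary_tensors_approximate by blast
  have "T x = T' x" if "x \<in> cspan {ten h e |h e. True}" for x
    using that
  proof (induction rule: complex_vector.span_induct_alt)
    case (step c x y)
    then show ?case
      using T eq by (auto simp: blinfun.add_right cblin_def)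
  qed (simp add: blinfun.zero_right)
  then have "T (s n) = T' (s n)" for n
    using s(1) by blast
  moreover have "(\<lambda>n. T (s n)) \<longlonglongrightarrow> T u" "(\<lambda>n. T' (s n)) \<longlonglongrightarrow> T' u"
    by (intro blinfun.tendsto tendsto_const s(2))+
  ultimately show "T u = T' u"
    by (simp add: LIMSEQ_unique)
qed

lemma tensor_cinner_eqI:
  assumes eq: "\<And>h e. cinner v (ten h e) = cinner v' (ten h e)"
  shows "v = v'"
proof -
  have bl: "bounded_linear (\<lambda>x. cinner x w)" for w :: 't
    by (rule bounded_linear_cinner_left)
  have "Blinfun (\<lambda>x. cinner x v) = Blinfun (\<lambda>x. cinner x v')"
  proof (rule tensor_blinfun_eqI)
    show "Blinfun (\<lambda>x. cinner x v) (ten h e) = Blinfun (\<lambda>x. cinner x v') (ten h e)" for h e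
      unfolding bounded_linear_Blinfun_apply[OF bl] by (metis eq cinner_commute)
  qed (simp_all add: cblin_def bounded_linear_Blinfun_apply[OF bl] cinner_scaleC_left scaleC_complex_def)
  then have "cinner x v = cinner x v'" for x
    by (metis bounded_linear_Blinfun_apply[OF bl])
  then show ?thesis
    using cinner_eqI cinner_commute by metis
qed

text \<open>The vector \<open>v = (K \<otimes> 1) u\<close> is characterised by \<open>\<langle>v, h \<otimes> e\<rangle> = \<langle>u, K\<^sup>* h \<otimes> e\<rangle>\<close>. This relation
  is linear and closed, and determines \<open>v\<close>. On a finite sum of elementary tensors the vector exists
  and is bounded slice by slice; completeness yields it everywhere.\<close>

lemma op_tensor_id_exists:
  assumes K: "K \<in> cblin"
  shows "\<exists>T\<in>cblin. \<forall>h e. blinfun_apply T (ten h e) = ten (K h) e"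
proof -
  define R where "R u v \<longleftrightarrow> (\<forall>h e. cinner v (ten h e) = cinner u (ten (adj K h) e))" for u v :: 't
  have R_unique: "v = v'" if "R u v" "R u v'" for u v v'
    by (rule tensor_cinner_eqI) (use that in \<open>simp add: R_def\<close>)
  have R_add: "R (u + u') (v + v')" if "R u v" "R u' v'" for u u' v v'
    using that by (simp add: R_def cinner_add_left)
  have R_diff: "R (u - u') (v - v')" if "R u v" "R u' v'" for u u' v v'
    using that by (simp add: R_def cinner_diff_left)
  have R_scaleC: "R (c *\<^sub>C u) (c *\<^sub>C v)" if "R u v" for c u v
    using that by (simp add: R_def cinner_scaleC_left)
  have R_lim: "R u v" if "\<And>n. R (s n) (t n)" "s \<longlonglongrightarrow> u" "t \<longlonglongrightarrow> v" for s t u v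
    unfolding R_def
  proof (intro allI LIMSEQ_unique)
    fix h e
    show "(\<lambda>n. cinner (t n) (ten h e)) \<longlonglongrightarrow> cinner v (ten h e)"
      by (rule bounded_linear.tendsto[OF bounded_linear_cinner_left that(3)])
    show "(\<lambda>n. cinner (t n) (ten h e)) \<longlonglongrightarrow> cinner u (ten (adj K h) e)"
      using bounded_linear.tendsto[OF bounded_linear_cinner_left that(2)] that(1)
      by (simp add: R_def)
  qed
  have R_ten: "R (ten h e) (ten (K h) e)" for h e
    by (simp add: R_def cinner_ten cinner_adj[OF K])
  have R_sum: "R (\<Sum>b\<in>B. ten (f b) b) (\<Sum>b\<in>B. ten (K (f b)) b)" for B f
    using R_ten by (simp add: R_def cinner_sum_left)
  have R_span: "\<exists>v. R u v \<and> norm v \<le> norm K * norm u"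
    if u_span: "u \<in> cspan {ten h e |h e. True}" for u
  proof -
    obtain B f where B: "finite B" "orthonormal B (\<lambda>b. b)" and u: "u = (\<Sum>b\<in>B. ten (f b) b)"
      using slices_exist[OF u_span, of "{}"] by (auto simp: orthonormal_def)
    have "(norm (\<Sum>b\<in>B. ten (K (f b)) b))\<^sup>2 = (\<Sum>b\<in>B. (norm (K (f b)))\<^sup>2)"
      by (rule norm_slices[OF B])
    also have "\<dots> \<le> (\<Sum>b\<in>B. (norm K * norm (f b))\<^sup>2)"
      by (intro sum_mono power_mono norm_blinfun) simp
    also have "\<dots> = (norm K * norm u)\<^sup>2"
      by (simp add: u power_mult_distrib norm_slices[OF B] sum_distrib_left)
    finally have "norm (\<Sum>b\<in>B. ten (K (f b)) b) \<le> norm K * norm u"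
      by (rule power2_le_imp_le) simp
    then show ?thesis
      using R_sum u by blast
  qed
  have "\<exists>v. R u v \<and> norm v \<le> norm K * norm u" for u
  proof -
    obtain s where s: "\<And>n::nat. s n \<in> cspan {ten h e |h e. True}" "s \<longlonglongrightarrow> u"
      using elementary_tensors_approximate by blast
    obtain t where t: "\<And>n. R (s n) (t n)" "\<And>n. norm (t n) \<le> norm K * norm (s n)"
      using R_span[OF s(1)] by metis
    have lip: "norm (t m - t n) \<le> norm K * norm (s m - s n)" for m n
    proof -
      obtain v where "R (s m - s n) v" "norm v \<le> norm K * norm (s m - s n)"
        using R_span complex_vector.span_diff[OF s(1) s(1)] by blast
      then show ?thesis
        using R_unique R_diff[OF t(1) t(1)] by metis
    qed
    have "Cauchy t"
    proof (rule metric_CauchyI)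
      fix d :: real
      assume "0 < d"
      define d' where "d' = d / (norm K + 1)"
      have "0 < norm K + 1"
        by (simp add: add_nonneg_pos)
      then have "0 < d'"
        using \<open>0 < d\<close> by (simp add: d'_def)
      then obtain M where M: "\<And>m n. M \<le> m \<Longrightarrow> M \<le> n \<Longrightarrow> dist (s m) (s n) < d'"
        using metric_CauchyD[OF LIMSEQ_imp_Cauchy[OF s(2)]] by blast
      have "dist (t m) (t n) < d" if "M \<le> m" "M \<le> n" for m n
      proof -
        have "norm (t m - t n) \<le> norm K * norm (s m - s n)"
          by (rule lip)
        also have "\<dots> \<le> norm K * d'"
          using M[OF that] by (intro mult_left_mono) (auto simp: dist_norm)
        also have "\<dots> < (norm K + 1) * d'"
          using \<open>0 < d'\<close> by simp
        also have "\<dots> = d"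
          using \<open>0 < norm K + 1\<close> by (simp add: d'_def)
        finally show ?thesis
          by (simp add: dist_norm)
      qed
      then show "\<exists>M. \<forall>m\<ge>M. \<forall>n\<ge>M. dist (t m) (t n) < d"
        by blast
    qed
    then obtain v where v: "t \<longlonglongrightarrow> v"
      using Cauchy_convergent convergent_def by blast
    have "norm v \<le> norm K * norm u"
      by (rule LIMSEQ_le[OF tendsto_norm[OF v] tendsto_mult_left[OF tendsto_norm[OF s(2)]]])
        (use t(2) in auto)
    then show ?thesis
      using R_lim[OF t(1) s(2) v] by blast
  qed
  then obtain g where g: "\<And>u. R u (g u)" "\<And>u. norm (g u) \<le> norm K * norm u"
    by metis
  have g_eq: "g u = v" if "R u v" for u v
    using R_unique g(1) that by blast
  have g_scaleC: "g (c *\<^sub>C u) = c *\<^sub>C g u" for c u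
    by (intro g_eq R_scaleC g(1))
  have bl: "bounded_linear g"
  proof (rule bounded_linear_intro[where K = "norm K"])
    show "g (u + u') = g u + g u'" for u u'
      by (intro g_eq R_add g(1))
    show "g (r *\<^sub>R u) = r *\<^sub>R g u" for r u
      by (simp add: scaleR_scaleC g_scaleC)
    show "norm (g u) \<le> norm u * norm K" for u
      using g(2)[of u] by (simp add: mult.commute)
  qed
  have "Blinfun g \<in> cblin"
    by (simp add: cblin_def bounded_linear_Blinfun_apply[OF bl] g_scaleC)
  moreover have "Blinfun g (ten h e) = ten (K h) e" for h e
    by (simp add: bounded_linear_Blinfun_apply[OF bl] g_eq R_ten)
  ultimately show ?thesis
    by blast
qed

lemma op_tensor_eqI:
  assumes "T \<in> cblin" "\<And>h e. blinfun_apply T (ten h e) = ten (blinfun_apply X h) (blinfun_apply A e)"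
  shows "op_tensor ten X A = T"
  unfolding op_tensor_def
  by (rule the_equality) (use assms in \<open>auto intro: tensor_blinfun_eqI\<close>)

end

lemma cblin_id [simp]: "id_blinfun \<in> cblin"
  by (simp add: cblin_def)

lemma cblin_compose: "S \<in> cblin \<Longrightarrow> T \<in> cblin \<Longrightarrow> S o\<^sub>L T \<in> cblin"
  by (simp add: cblin_def)

lemma cblin_diff: "S \<in> cblin \<Longrightarrow> T \<in> cblin \<Longrightarrow> S - T \<in> cblin"
  by (simp add: cblin_def blinfun.diff_left scaleC_diff_right)

context
  fixes ten :: "'h::chilbert_space \<Rightarrow> 'e::chilbert_space \<Rightarrow> 't::chilbert_space"
  assumes tensor: "hilbert_tensor ten"
begin

lemma op_tensor:
  assumes X: "X \<in> cblin" and A: "A \<in> cblin"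
  shows op_tensor_cblin: "op_tensor ten X A \<in> cblin"
    and op_tensor_ten: "op_tensor ten X A (ten h e) = ten (X h) (A e)"
proof -
  obtain S where S: "S \<in> cblin" "\<forall>h e. blinfun_apply S (ten h e) = ten (X h) e"
    using op_tensor_id_exists[OF tensor X] by (rule bexE)
  obtain T where T: "T \<in> cblin" "\<forall>e h. blinfun_apply T (ten h e) = ten h (A e)"
    using op_tensor_id_exists[OF hilbert_tensor_flip[OF tensor] A] by (rule bexE)
  have "op_tensor ten X A = S o\<^sub>L T"
    by (rule op_tensor_eqI[OF tensor]) (simp_all add: S T cblin_compose)
  then show "op_tensor ten X A \<in> cblin" "op_tensor ten X A (ten h e) = ten (X h) (A e)"
    by (simp_all add: S T cblin_compose)
qed

lemma op_tensor_split:
  assumes "X \<in> cblin" "A \<in> cblin"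
  shows "op_tensor ten X A = op_tensor ten X id_blinfun o\<^sub>L op_tensor ten id_blinfun A"
  by (rule op_tensor_eqI[OF tensor]) (simp_all add: assms op_tensor cblin_compose)

lemma op_tensor_compose:
  assumes "X \<in> cblin" "X' \<in> cblin"
  shows "op_tensor ten (X o\<^sub>L X') id_blinfun
    = op_tensor ten X id_blinfun o\<^sub>L op_tensor ten X' id_blinfun"
  by (rule op_tensor_eqI[OF tensor]) (simp_all add: assms op_tensor cblin_compose)

lemma op_tensor_id: "op_tensor ten id_blinfun id_blinfun = id_blinfun"
  by (rule op_tensor_eqI[OF tensor]) simp_all

lemma op_tensor_diff:
  assumes "A \<in> cblin" "A' \<in> cblin"
  shows "op_tensor ten id_blinfun (A - A')
    = op_tensor ten id_blinfun A - op_tensor ten id_blinfun A'"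
proof (rule op_tensor_eqI[OF tensor])
  have ten_diff: "ten h (e - e') = ten h e - ten h e'" for h e e'
    using ten_add_right[OF tensor, of h "e - e'" e'] by simp
  show "(op_tensor ten id_blinfun A - op_tensor ten id_blinfun A') (ten h e)
      = ten (id_blinfun h) ((A - A') e)" for h e
    by (simp add: assms op_tensor blinfun.diff_left ten_diff)
qed (simp add: assms op_tensor cblin_diff)

lemma op_tensor_flip:
  assumes "X \<in> cblin" "A \<in> cblin"
  shows "op_tensor (\<lambda>e h. ten h e) A X = op_tensor ten X A"
  by (rule op_tensor_eqI[OF hilbert_tensor_flip[OF tensor]]) (simp_all add: assms op_tensor)

text \<open>Along common slices the expression for the row of the \<open>K\<^sub>i \<otimes> 1\<close> is a sum of the corresponding
  expressions for the row of the \<open>K\<^sub>i\<close>, and general vectors are limits of sums of elementary tensors. An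
  upper bound for a row operator is the case \<open>\<sigma> < 0 < \<tau>\<close>, a lower bound the case \<open>\<tau> < 0 < \<sigma>\<close>.\<close>

lemma row_estimate_tensor:
  assumes K: "\<And>i. i \<in> I \<Longrightarrow> K i \<in> cblin" and I: "finite I"
    and est: "\<And>y. 0 \<le> \<sigma> * (norm (\<Sum>i\<in>I. blinfun_apply (K i) (y i)))\<^sup>2 + \<tau> * (\<Sum>i\<in>I. (norm (y i))\<^sup>2)"
  shows "0 \<le> \<sigma> * (norm (\<Sum>i\<in>I. op_tensor ten (K i) id_blinfun (v i)))\<^sup>2
    + \<tau> * (\<Sum>i\<in>I. (norm (v i))\<^sup>2)"
proof -
  define T where "T i = op_tensor ten (K i) id_blinfun" for i
  define q where "q v = \<sigma> * (norm (\<Sum>i\<in>I. T i (v i)))\<^sup>2 + \<tau> * (\<Sum>i\<in>I. (norm (v i))\<^sup>2)" for v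
  have algebraic: "0 \<le> q v" if span: "\<And>i. v i \<in> cspan {ten h e |h e. True}" for v
  proof -
    obtain B f where B: "finite B" "orthonormal B (\<lambda>b. b)"
      and v: "\<forall>i\<in>I. v i = (\<Sum>b\<in>B. ten (f i b) b)"
      using common_slices_exist[OF tensor I, of v] span by blast
    have "(\<Sum>i\<in>I. T i (v i)) = (\<Sum>i\<in>I. \<Sum>b\<in>B. ten (K i (f i b)) b)"
      by (intro sum.cong) (simp_all add: T_def v blinfun.sum_right op_tensor K)
    also have "\<dots> = (\<Sum>b\<in>B. ten (\<Sum>i\<in>I. K i (f i b)) b)"
      by (subst sum.swap) (simp add: ten_sum_left[OF tensor])
    finally have "(norm (\<Sum>i\<in>I. T i (v i)))\<^sup>2 = (\<Sum>b\<in>B. (norm (\<Sum>i\<in>I. K i (f i b)))\<^sup>2)"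
      by (simp add: norm_slices[OF tensor B])
    moreover have "(\<Sum>i\<in>I. (norm (v i))\<^sup>2) = (\<Sum>b\<in>B. \<Sum>i\<in>I. (norm (f i b))\<^sup>2)"
      by (subst sum.swap) (simp add: v norm_slices[OF tensor B])
    ultimately have "q v = (\<Sum>b\<in>B. \<sigma> * (norm (\<Sum>i\<in>I. K i (f i b)))\<^sup>2 + \<tau> * (\<Sum>i\<in>I. (norm (f i b))\<^sup>2))"
      by (simp add: q_def sum.distrib sum_distrib_left)
    also have "0 \<le> \<dots>"
      by (intro sum_nonneg est)
    finally show ?thesis .
  qed
  have "\<exists>s. \<forall>i. (\<forall>n::nat. s i n \<in> cspan {ten h e |h e. True}) \<and> s i \<longlonglongrightarrow> v i"
    by (intro choice allI elementary_tensors_approximate[OF tensor])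
  then obtain s where s: "\<And>i n. s i n \<in> cspan {ten h e |h e. True}" "\<And>i. s i \<longlonglongrightarrow> v i"
    by blast
  have "(\<lambda>n. q (\<lambda>i. s i n)) \<longlonglongrightarrow> q v"
    unfolding q_def by (intro tendsto_intros blinfun.tendsto s(2))
  then have "0 \<le> q v"
    by (rule LIMSEQ_le_const) (intro exI allI impI algebraic s(1))
  then show ?thesis
    by (simp add: q_def T_def)
qed

lemma column_estimate_tensor_left:
  assumes K: "\<And>i. i \<in> I \<Longrightarrow> K i \<in> cblin"
    and est: "\<And>y. (\<Sum>i\<in>I. (norm (blinfun_apply (K i) y))\<^sup>2) \<le> c * (norm y)\<^sup>2"
  shows "(\<Sum>i\<in>I. (norm (op_tensor ten (K i) id_blinfun u))\<^sup>2) \<le> c * (norm u)\<^sup>2"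
proof -
  define T where "T i = op_tensor ten (K i) id_blinfun" for i
  have algebraic: "(\<Sum>i\<in>I. (norm (T i u))\<^sup>2) \<le> c * (norm u)\<^sup>2"
    if span: "u \<in> cspan {ten h e |h e. True}" for u
  proof -
    obtain B f where B: "finite B" "orthonormal B (\<lambda>b. b)" and u: "u = (\<Sum>b\<in>B. ten (f b) b)"
      using slices_exist[OF tensor span, of "{}"] by (auto simp: orthonormal_def)
    have "(\<Sum>i\<in>I. (norm (T i u))\<^sup>2) = (\<Sum>i\<in>I. \<Sum>b\<in>B. (norm (K i (f b)))\<^sup>2)"
      by (intro sum.cong)
        (simp_all add: T_def u blinfun.sum_right op_tensor K norm_slices[OF tensor B])
    also have "\<dots> = (\<Sum>b\<in>B. \<Sum>i\<in>I. (norm (K i (f b)))\<^sup>2)"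
      by (rule sum.swap)
    also have "\<dots> \<le> (\<Sum>b\<in>B. c * (norm (f b))\<^sup>2)"
      by (intro sum_mono est)
    also have "\<dots> = c * (norm u)\<^sup>2"
      by (simp add: u norm_slices[OF tensor B] sum_distrib_left)
    finally show ?thesis .
  qed
  obtain s where s: "\<And>n::nat. s n \<in> cspan {ten h e |h e. True}" "s \<longlonglongrightarrow> u"
    using elementary_tensors_approximate[OF tensor] by blast
  have "(\<Sum>i\<in>I. (norm (T i u))\<^sup>2) \<le> c * (norm u)\<^sup>2"
  proof (rule LIMSEQ_le)
    show "(\<lambda>n. \<Sum>i\<in>I. (norm (T i (s n)))\<^sup>2) \<longlonglongrightarrow> (\<Sum>i\<in>I. (norm (T i u))\<^sup>2)"
      "(\<lambda>n. c * (norm (s n))\<^sup>2) \<longlonglongrightarrow> c * (norm u)\<^sup>2"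
      by (intro tendsto_intros blinfun.tendsto s(2))+
  qed (intro exI allI impI algebraic s(1))
  then show ?thesis
    by (simp add: T_def)
qed

end

lemma column_estimate_tensor:
  assumes tensor: "hilbert_tensor ten" and K: "\<And>i. i \<in> I \<Longrightarrow> K i \<in> cblin"
    and est: "\<And>y. (\<Sum>i\<in>I. (norm (blinfun_apply (K i) y))\<^sup>2) \<le> c * (norm y)\<^sup>2"
  shows "(\<Sum>i\<in>I. (norm (op_tensor ten id_blinfun (K i) u))\<^sup>2) \<le> c * (norm u)\<^sup>2"
  using column_estimate_tensor_left[OF hilbert_tensor_flip[OF tensor] K est]
  by (simp add: op_tensor_flip[OF tensor] K)


section \<open>Row operators indexed by words\<close>

definition row_upper :: "('n \<Rightarrow> 't::real_normed_vector \<Rightarrow>\<^sub>L 't) \<Rightarrow> real \<Rightarrow> bool"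
  where "row_upper Y r \<longleftrightarrow>
    (\<forall>I v. finite I \<longrightarrow> (norm (\<Sum>i\<in>I. Y i (v i)))\<^sup>2 \<le> r\<^sup>2 * (\<Sum>i\<in>I. (norm (v i))\<^sup>2))"

definition row_lower :: "('n \<Rightarrow> 't::real_normed_vector \<Rightarrow>\<^sub>L 't) \<Rightarrow> real \<Rightarrow> bool"
  where "row_lower Y C \<longleftrightarrow>
    (\<forall>I v. finite I \<longrightarrow> C\<^sup>2 * (\<Sum>i\<in>I. (norm (v i))\<^sup>2) \<le> (norm (\<Sum>i\<in>I. Y i (v i)))\<^sup>2)"

lemma word_op_Nil [simp]: "word_op Y [] = id_blinfun"
  and word_op_Cons [simp]: "word_op Y (i # \<beta>) = Y i o\<^sub>L word_op Y \<beta>"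
  by (simp_all add: word_op_def)

lemma sum_by_first_letter:
  assumes "finite Z" "[] \<notin> Z" "finite J" "hd ` Z \<subseteq> J"
  shows "(\<Sum>\<gamma>\<in>Z. f \<gamma>) = (\<Sum>i\<in>J. \<Sum>\<beta>\<in>(#) i -` Z. f (i # \<beta>))"
proof -
  have split: "hd \<gamma> # tl \<gamma> = \<gamma>" if "\<gamma> \<in> Z" for \<gamma>
    using assms(2) that by (metis hd_Cons_tl)
  have "(\<Sum>\<beta>\<in>(#) i -` Z. f (i # \<beta>)) = (\<Sum>\<gamma>\<in>{\<gamma>. \<gamma> \<in> Z \<and> hd \<gamma> = i}. f \<gamma>)" for i
    by (rule sum.reindex_bij_witness[where i = tl and j = "(#) i"])
      (auto simp: split)
  then show ?thesis
    using sum.group[OF assms(1,3,4), of f] by simp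
qed

lemma L2_set_by_first_letter:
  assumes "finite Z" "[] \<notin> Z" "finite J" "hd ` Z \<subseteq> J"
  shows "L2_set f Z = L2_set (\<lambda>i. L2_set (\<lambda>\<beta>. f (i # \<beta>)) ((#) i -` Z)) J"
  by (simp add: L2_set_def sum_nonneg sum_by_first_letter[OF assms])

lemma row_sum_by_first_letter:
  assumes "finite Z" "[] \<notin> Z" "finite J" "hd ` Z \<subseteq> J"
  shows "(\<Sum>\<gamma>\<in>Z. word_op Y \<gamma> (v \<gamma>))
    = (\<Sum>i\<in>J. Y i (\<Sum>\<beta>\<in>(#) i -` Z. word_op Y \<beta> (v (i # \<beta>))))"
  unfolding sum_by_first_letter[OF assms] by (simp add: blinfun.sum_right)

text \<open>The words with first letter \<open>i\<close> contribute \<open>Y\<^sub>i\<close> applied to a sum over their tails.\<close>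

lemma row_upper_prepend:
  assumes upper: "row_upper Y r" and Z: "finite Z" "[] \<notin> Z"
    and tails: "\<And>i. (norm (\<Sum>\<beta>\<in>(#) i -` Z. word_op Y \<beta> (v (i # \<beta>))))\<^sup>2
      \<le> K * (\<Sum>\<beta>\<in>(#) i -` Z. (norm (v (i # \<beta>)))\<^sup>2)"
  shows "(norm (\<Sum>\<gamma>\<in>Z. word_op Y \<gamma> (v \<gamma>)))\<^sup>2 \<le> r\<^sup>2 * K * (\<Sum>\<gamma>\<in>Z. (norm (v \<gamma>))\<^sup>2)"
proof -
  define w where "w i = (\<Sum>\<beta>\<in>(#) i -` Z. word_op Y \<beta> (v (i # \<beta>)))" for i
  have J: "finite (hd ` Z)" "hd ` Z \<subseteq> hd ` Z"
    using Z(1) by auto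
  have "(norm (\<Sum>\<gamma>\<in>Z. word_op Y \<gamma> (v \<gamma>)))\<^sup>2 = (norm (\<Sum>i\<in>hd ` Z. Y i (w i)))\<^sup>2"
    by (simp only: row_sum_by_first_letter[OF Z J] w_def)
  also have "\<dots> \<le> r\<^sup>2 * (\<Sum>i\<in>hd ` Z. (norm (w i))\<^sup>2)"
    using upper J(1) by (simp add: row_upper_def)
  also have "\<dots> \<le> r\<^sup>2 * (\<Sum>i\<in>hd ` Z. K * (\<Sum>\<beta>\<in>(#) i -` Z. (norm (v (i # \<beta>)))\<^sup>2))"
    unfolding w_def by (intro mult_left_mono sum_mono tails) simp
  also have "\<dots> = r\<^sup>2 * K * (\<Sum>\<gamma>\<in>Z. (norm (v \<gamma>))\<^sup>2)"
    by (simp only: sum_by_first_letter[OF Z J] sum_distrib_left mult.assoc)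
  finally show ?thesis .
qed

text \<open>The constant \<open>q = r\<^sup>2 / (1 - r\<^sup>2)\<close> satisfies \<open>1 + q = 1 / (1 - r\<^sup>2)\<close> and \<open>r\<^sup>2 (1 + q) = q\<close>, so the
  bound \<open>1 + q\<close> reproduces itself when the empty word is added to the words with a first letter.\<close>

lemma row_upper_words_aux:
  assumes upper: "row_upper Y r" and r: "0 \<le> r" "r < 1"
    and "finite Z" "\<And>\<gamma>. \<gamma> \<in> Z \<Longrightarrow> length \<gamma> < N"
  shows "(norm (\<Sum>\<gamma>\<in>Z. word_op Y \<gamma> (v \<gamma>)))\<^sup>2 \<le> 1 / (1 - r\<^sup>2) * (\<Sum>\<gamma>\<in>Z. (norm (v \<gamma>))\<^sup>2)"
  using assms(4,5)
proof (induction N arbitrary: Z v)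
  case 0
  then have "Z = {}"
    by blast
  then show ?case
    by simp
next
  case (Suc N)
  define q where "q = r\<^sup>2 / (1 - r\<^sup>2)"
  have r2: "r\<^sup>2 < 1"
    using r by (simp add: power_less_one_iff)
  then have q: "0 \<le> q" "1 / (1 - r\<^sup>2) = 1 + q" "r\<^sup>2 * (1 / (1 - r\<^sup>2)) = q"
    by (simp_all add: q_def field_simps)
  define Z' where "Z' = Z - {[]}"
  have Z': "finite Z'" "[] \<notin> Z'"
    using Suc.prems by (auto simp: Z'_def)
  define w where "w = (\<Sum>\<gamma>\<in>Z'. word_op Y \<gamma> (v \<gamma>))"
  define s where "s = (\<Sum>\<gamma>\<in>Z'. (norm (v \<gamma>))\<^sup>2)"
  define a where "a = (if [] \<in> Z then v [] else 0)"
  have "(norm w)\<^sup>2 \<le> r\<^sup>2 * (1 / (1 - r\<^sup>2)) * s"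
    unfolding w_def s_def
  proof (rule row_upper_prepend[OF upper Z'])
    show "(norm (\<Sum>\<beta>\<in>(#) i -` Z'. word_op Y \<beta> (v (i # \<beta>))))\<^sup>2
      \<le> 1 / (1 - r\<^sup>2) * (\<Sum>\<beta>\<in>(#) i -` Z'. (norm (v (i # \<beta>)))\<^sup>2)" for i
      by (rule Suc.IH) (use Z' in \<open>auto simp: Z'_def finite_vimageI dest: Suc.prems(2)\<close>)
  qed
  then have w: "(norm w)\<^sup>2 \<le> q * s"
    unfolding q(3) .
  have s: "0 \<le> s"
    by (simp add: s_def sum_nonneg)
  have cross: "2 * norm a * norm w \<le> q * (norm a)\<^sup>2 + s"
  proof (rule power2_le_imp_le)
    have "(2 * norm a * norm w)\<^sup>2 = 4 * (norm a)\<^sup>2 * (norm w)\<^sup>2"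
      by (simp add: power_mult_distrib)
    also have "\<dots> \<le> 4 * (norm a)\<^sup>2 * (q * s)"
      by (intro mult_left_mono w) simp
    also have "\<dots> \<le> (q * (norm a)\<^sup>2 + s)\<^sup>2"
      using zero_le_power2[of "q * (norm a)\<^sup>2 - s"]
      by (simp add: power2_diff power2_sum algebra_simps)
    finally show "(2 * norm a * norm w)\<^sup>2 \<le> (q * (norm a)\<^sup>2 + s)\<^sup>2" .
  qed (use q s in simp)
  have "(norm (a + w))\<^sup>2 \<le> (norm a + norm w)\<^sup>2"
    by (intro power_mono norm_triangle_ineq) simp
  also have "\<dots> = (norm a)\<^sup>2 + 2 * norm a * norm w + (norm w)\<^sup>2"
    by (simp add: power2_sum)
  also have "\<dots> \<le> (1 + q) * ((norm a)\<^sup>2 + s)"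
    using cross w by (simp add: algebra_simps)
  finally have "(norm (a + w))\<^sup>2 \<le> 1 / (1 - r\<^sup>2) * ((norm a)\<^sup>2 + s)"
    by (simp only: q)
  moreover have "(\<Sum>\<gamma>\<in>Z. word_op Y \<gamma> (v \<gamma>)) = a + w" "(\<Sum>\<gamma>\<in>Z. (norm (v \<gamma>))\<^sup>2) = (norm a)\<^sup>2 + s"
    unfolding w_def s_def a_def Z'_def
    using Suc.prems(1) by (auto simp: sum.remove[of Z "[]"])
  ultimately show ?case
    by simp
qed

lemma row_upper_words:
  assumes upper: "row_upper Y r" and r: "0 \<le> r" "r < 1"
    and "finite Z" "\<And>\<gamma>. \<gamma> \<in> Z \<Longrightarrow> k \<le> length \<gamma>"
  shows "(norm (\<Sum>\<gamma>\<in>Z. word_op Y \<gamma> (v \<gamma>)))\<^sup>2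
    \<le> (r\<^sup>2) ^ k / (1 - r\<^sup>2) * (\<Sum>\<gamma>\<in>Z. (norm (v \<gamma>))\<^sup>2)"
  using assms(4,5)
proof (induction k arbitrary: Z v)
  case 0
  have "length \<gamma> < Suc (Max (length ` Z))" if "\<gamma> \<in> Z" for \<gamma>
    using that 0 by (simp add: less_Suc_eq_le)
  then show ?case
    using row_upper_words_aux[OF upper r 0(1), of "Suc (Max (length ` Z))" v] by simp
next
  case (Suc k)
  then have "[] \<notin> Z"
    by force
  have "(norm (\<Sum>\<gamma>\<in>Z. word_op Y \<gamma> (v \<gamma>)))\<^sup>2
    \<le> r\<^sup>2 * ((r\<^sup>2) ^ k / (1 - r\<^sup>2)) * (\<Sum>\<gamma>\<in>Z. (norm (v \<gamma>))\<^sup>2)"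
  proof (rule row_upper_prepend[OF upper Suc.prems(1) \<open>[] \<notin> Z\<close>])
    show "(norm (\<Sum>\<beta>\<in>(#) i -` Z. word_op Y \<beta> (v (i # \<beta>))))\<^sup>2
      \<le> (r\<^sup>2) ^ k / (1 - r\<^sup>2) * (\<Sum>\<beta>\<in>(#) i -` Z. (norm (v (i # \<beta>)))\<^sup>2)" for i
      by (rule Suc.IH) (auto simp: finite_vimageI Suc.prems(1) dest: Suc.prems(2))
  qed
  then show ?case
    by simp
qed

lemma row_upper_words_L2:
  assumes upper: "row_upper Y r" and r: "0 \<le> r" "r < 1"
    and "finite Z" "\<And>\<gamma>. \<gamma> \<in> Z \<Longrightarrow> k \<le> length \<gamma>"
  shows "norm (\<Sum>\<gamma>\<in>Z. word_op Y \<gamma> (v \<gamma>))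
    \<le> r ^ k / sqrt (1 - r\<^sup>2) * L2_set (\<lambda>\<gamma>. norm (v \<gamma>)) Z"
proof (rule power2_le_imp_le)
  have "r\<^sup>2 < 1"
    using r by (simp add: power_less_one_iff)
  then have "(r ^ k / sqrt (1 - r\<^sup>2) * L2_set (\<lambda>\<gamma>. norm (v \<gamma>)) Z)\<^sup>2
    = (r\<^sup>2) ^ k / (1 - r\<^sup>2) * (\<Sum>\<gamma>\<in>Z. (norm (v \<gamma>))\<^sup>2)"
    by (simp add: power_mult_distrib power_divide L2_set_def sum_nonneg flip: power_mult)
      (simp add: mult.commute)
  then show "(norm (\<Sum>\<gamma>\<in>Z. word_op Y \<gamma> (v \<gamma>)))\<^sup>2
    \<le> (r ^ k / sqrt (1 - r\<^sup>2) * L2_set (\<lambda>\<gamma>. norm (v \<gamma>)) Z)\<^sup>2"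
    using row_upper_words[OF assms] by simp
  show "0 \<le> r ^ k / sqrt (1 - r\<^sup>2) * L2_set (\<lambda>\<gamma>. norm (v \<gamma>)) Z"
    using r \<open>r\<^sup>2 < 1\<close> by simp
qed

text \<open>Factoring the first letter out of a sum over words of length at least \<open>k + 1\<close> and using the lower
  bound of the row removes one letter. After \<open>k\<close> steps the entries of length \<open>k\<close> stand alone,
  perturbed only by longer words, whose contribution carries a factor \<open>r\<close>.\<close>

lemma row_lower_words:
  assumes upper: "row_upper Y r" and r: "0 \<le> r" "r < 1"
    and lower: "row_lower Y C" and C: "0 < C"
    and "finite Z" "\<And>\<gamma>. \<gamma> \<in> Z \<Longrightarrow> k \<le> length \<gamma>"
  shows "C ^ k * L2_set (\<lambda>\<gamma>. norm (v \<gamma>)) {\<gamma> \<in> Z. length \<gamma> = k}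
    \<le> norm (\<Sum>\<gamma>\<in>Z. word_op Y \<gamma> (v \<gamma>)) + C ^ k * (r / sqrt (1 - r\<^sup>2)) * L2_set (\<lambda>\<gamma>. norm (v \<gamma>)) Z"
  using assms(6,7)
proof (induction k arbitrary: Z v)
  case 0
  define Z' where "Z' = Z - {[]}"
  define w where "w = (\<Sum>\<gamma>\<in>Z'. word_op Y \<gamma> (v \<gamma>))"
  define a where "a = (if [] \<in> Z then v [] else 0)"
  have r2: "r\<^sup>2 < 1"
    using r by (simp add: power_less_one_iff)
  have "(\<Sum>\<gamma>\<in>Z. word_op Y \<gamma> (v \<gamma>)) = a + w"
    unfolding w_def a_def Z'_def using 0 by (auto simp: sum.remove[of Z "[]"])
  moreover have "L2_set (\<lambda>\<gamma>. norm (v \<gamma>)) {\<gamma> \<in> Z. length \<gamma> = 0} = norm a"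
  proof -
    have "{\<gamma> \<in> Z. length \<gamma> = 0} = (if [] \<in> Z then {[]} else {})"
      by auto
    then show ?thesis
      by (simp add: a_def)
  qed
  moreover have "norm w \<le> r ^ 1 / sqrt (1 - r\<^sup>2) * L2_set (\<lambda>\<gamma>. norm (v \<gamma>)) Z'"
    unfolding w_def
    by (rule row_upper_words_L2[OF upper r])
      (use 0 in \<open>auto simp: Z'_def Suc_le_eq\<close>)
  moreover have "L2_set (\<lambda>\<gamma>. norm (v \<gamma>)) Z' \<le> L2_set (\<lambda>\<gamma>. norm (v \<gamma>)) Z"
    unfolding L2_set_def by (intro real_sqrt_le_mono sum_mono2) (use 0 in \<open>auto simp: Z'_def\<close>)
  then have "r / sqrt (1 - r\<^sup>2) * L2_set (\<lambda>\<gamma>. norm (v \<gamma>)) Z'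
    \<le> r / sqrt (1 - r\<^sup>2) * L2_set (\<lambda>\<gamma>. norm (v \<gamma>)) Z"
    by (rule mult_left_mono) (use r r2 in simp)
  moreover have "norm a \<le> norm (a + w) + norm w"
    using norm_triangle_ineq4[of "a + w" w] by simp
  ultimately show ?case
    by simp
next
  case (Suc k)
  define \<kappa> where "\<kappa> = r / sqrt (1 - r\<^sup>2)"
  have nil: "[] \<notin> Z"
    using Suc.prems by force
  define J where "J = hd ` Z"
  have J: "finite J" "hd ` Z \<subseteq> J"
    using Suc.prems(1) by (auto simp: J_def)
  define Z\<^sub>k where "Z\<^sub>k = {\<gamma> \<in> Z. length \<gamma> = Suc k}"
  have Zk: "finite Z\<^sub>k" "[] \<notin> Z\<^sub>k" "hd ` Z\<^sub>k \<subseteq> J"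
    using Suc.prems(1) nil by (auto simp: Z\<^sub>k_def J_def)
  define p where "p i = L2_set (\<lambda>\<beta>. norm (v (i # \<beta>))) ((#) i -` Z\<^sub>k)" for i
  define q where "q i = L2_set (\<lambda>\<beta>. norm (v (i # \<beta>))) ((#) i -` Z)" for i
  define w where "w i = (\<Sum>\<beta>\<in>(#) i -` Z. word_op Y \<beta> (v (i # \<beta>)))" for i
  have "C ^ k * p i \<le> norm (w i) + C ^ k * \<kappa> * q i" for i
  proof -
    have "(#) i -` Z\<^sub>k = {\<beta> \<in> (#) i -` Z. length \<beta> = k}"
      by (auto simp: Z\<^sub>k_def)
    then show ?thesis
      unfolding p_def q_def w_def \<kappa>_def
      by (simp only:)
        (rule Suc.IH, auto simp: finite_vimageI Suc.prems(1) dest: Suc.prems(2))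
  qed
  then have "L2_set (\<lambda>i. C ^ k * p i) J \<le> L2_set (\<lambda>i. norm (w i) + C ^ k * \<kappa> * q i) J"
    by (intro L2_set_mono) (use C in \<open>auto simp: p_def\<close>)
  also have "\<dots> \<le> L2_set (\<lambda>i. norm (w i)) J + L2_set (\<lambda>i. C ^ k * \<kappa> * q i) J"
    by (rule L2_set_triangle_ineq)
  finally have *: "C ^ k * L2_set p J \<le> L2_set (\<lambda>i. norm (w i)) J + C ^ k * \<kappa> * L2_set q J"
  proof -
    have "r\<^sup>2 < 1"
      using r by (simp add: power_less_one_iff)
    then have "0 \<le> \<kappa>"
      using r by (simp add: \<kappa>_def)
    moreover assume "L2_set (\<lambda>i. C ^ k * p i) J
      \<le> L2_set (\<lambda>i. norm (w i)) J + L2_set (\<lambda>i. C ^ k * \<kappa> * q i) J"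
    ultimately show ?thesis
      using C by (simp add: L2_set_right_distrib)
  qed
  have "(C * L2_set (\<lambda>i. norm (w i)) J)\<^sup>2 \<le> (norm (\<Sum>i\<in>J. Y i (w i)))\<^sup>2"
    using lower J(1) by (simp add: row_lower_def power_mult_distrib L2_set_def sum_nonneg)
  then have "C * L2_set (\<lambda>i. norm (w i)) J \<le> norm (\<Sum>i\<in>J. Y i (w i))"
    by (rule power2_le_imp_le) simp
  also have "(\<Sum>i\<in>J. Y i (w i)) = (\<Sum>\<gamma>\<in>Z. word_op Y \<gamma> (v \<gamma>))"
    by (simp only: row_sum_by_first_letter[OF Suc.prems(1) nil J] w_def)
  finally have "C * (C ^ k * L2_set p J)
    \<le> norm (\<Sum>\<gamma>\<in>Z. word_op Y \<gamma> (v \<gamma>)) + C * (C ^ k * \<kappa> * L2_set q J)"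
    using mult_left_mono[OF *, of C] C by (simp add: distrib_left)
  moreover have "L2_set p J = L2_set (\<lambda>\<gamma>. norm (v \<gamma>)) Z\<^sub>k"
    unfolding p_def by (rule L2_set_by_first_letter[OF Zk(1,2) J(1) Zk(3), symmetric])
  moreover have "L2_set q J = L2_set (\<lambda>\<gamma>. norm (v \<gamma>)) Z"
    unfolding q_def by (rule L2_set_by_first_letter[OF Suc.prems(1) nil J, symmetric])
  ultimately show ?case
    by (simp add: Z\<^sub>k_def \<kappa>_def mult.assoc)
qed


section \<open>Strongly convergent word series\<close>

text \<open>The series over words need not converge absolutely; their partial sums are dominated by those of
  a convergent series of squares, which gives the Cauchy criterion.\<close>

lemma square_dominated_summable:
  fixes f :: "'i \<Rightarrow> 'a::{real_normed_vector, complete_space}" and g :: "'i \<Rightarrow> real"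
  assumes g: "g summable_on W" "\<And>x. x \<in> W \<Longrightarrow> 0 \<le> g x" and K: "0 \<le> K"
    and est: "\<And>Z. finite Z \<Longrightarrow> Z \<subseteq> W \<Longrightarrow> (norm (sum f Z))\<^sup>2 \<le> K * sum g Z"
  shows "f summable_on W"
proof -
  obtain S where S: "(g has_sum S) W"
    using g(1) summable_on_def by blast
  have "\<exists>P. eventually P (finite_subsets_at_top W) \<and>
      (\<forall>F F'. P F \<and> P F' \<longrightarrow> dist (sum f F) (sum f F') < e)" if "0 < e" for e
  proof -
    define d where "d = (e/4)\<^sup>2 / (K + 1)"
    have "0 < d"
      using \<open>0 < e\<close> K by (simp add: d_def)
    then obtain F\<^sub>0 where F0: "finite F\<^sub>0" "F\<^sub>0 \<subseteq> W" "dist (sum g F\<^sub>0) S \<le> d"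
      using has_sum_finite_approximation[OF S] by blast
    define P where "P F \<longleftrightarrow> finite F \<and> F\<^sub>0 \<subseteq> F \<and> F \<subseteq> W" for F
    have near: "dist (sum f F) (sum f F\<^sub>0) < e / 2" if "P F" for F
    proof -
      have F: "finite F" "F\<^sub>0 \<subseteq> F" "F \<subseteq> W"
        using that by (simp_all add: P_def)
      have "sum g (F - F\<^sub>0) = sum g F - sum g F\<^sub>0"
        using F by (simp add: sum_diff)
      also have "\<dots> \<le> d"
        using finite_sum_le_has_sum[OF S F(1,3)] g(2) F0(3) by (simp add: dist_real_def)
      finally have "K * sum g (F - F\<^sub>0) \<le> K * d"
        by (intro mult_left_mono K)
      also have "\<dots> \<le> (K + 1) * d"
        using \<open>0 < d\<close> by simp
      also have "\<dots> = (e/4)\<^sup>2"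
        using K by (simp add: d_def)
      finally have "(norm (sum f (F - F\<^sub>0)))\<^sup>2 \<le> (e/4)\<^sup>2"
        using est[of "F - F\<^sub>0"] F by fastforce
      then have "norm (sum f (F - F\<^sub>0)) \<le> e / 4"
        by (rule power2_le_imp_le) (use \<open>0 < e\<close> in simp)
      then show ?thesis
        using F \<open>0 < e\<close> by (simp add: dist_norm sum_diff)
    qed
    have "eventually P (finite_subsets_at_top W)"
      unfolding eventually_finite_subsets_at_top P_def using F0 by blast
    moreover have "dist (sum f F) (sum f F') < e" if "P F" "P F'" for F F'
      using near[OF that(1)] near[OF that(2)] by (rule dist_triangle_half_l)
    ultimately show ?thesis
      by blast
  qed
  then have "cauchy_filter (filtermap (sum f) (finite_subsets_at_top W))"
    by (simp add: cauchy_filter_metric_filtermap)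
  moreover have "complete (UNIV :: 'a set)"
    by (meson Cauchy_convergent UNIV_I complete_def convergent_def)
  ultimately obtain L where "(sum f \<longlongrightarrow> L) (finite_subsets_at_top W)"
    using complete_uniform[where S = UNIV] by (force simp: filterlim_def)
  then show ?thesis
    using summable_on_def has_sum_def by blast
qed

text \<open>Testing finite subfamilies only makes this meaningful before any convergence is known; it says
  that the column operator \<open>x \<mapsto> (B \<gamma> x)\<^sub>\<gamma>\<close> has norm at most \<open>\<bar>c\<bar>\<close>.\<close>

definition column_bound :: "'w set \<Rightarrow> real \<Rightarrow> ('w \<Rightarrow> 'a::real_normed_vector \<Rightarrow>\<^sub>L 'b::real_normed_vector) \<Rightarrow> bool"
  where "column_bound W c B \<longleftrightarrow>
    (\<forall>V x. finite V \<longrightarrow> V \<subseteq> W \<longrightarrow> (\<Sum>\<gamma>\<in>V. (norm (B \<gamma> x))\<^sup>2) \<le> c\<^sup>2 * (norm x)\<^sup>2)"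

lemma column_boundD:
  "column_bound W c B \<Longrightarrow> finite V \<Longrightarrow> V \<subseteq> W \<Longrightarrow> (\<Sum>\<gamma>\<in>V. (norm (B \<gamma> x))\<^sup>2) \<le> c\<^sup>2 * (norm x)\<^sup>2"
  by (simp add: column_bound_def)

lemma column_bound_L2:
  assumes "column_bound W c B" "0 \<le> c" "finite V" "V \<subseteq> W"
  shows "L2_set (\<lambda>\<gamma>. norm (B \<gamma> x)) V \<le> c * norm x"
  unfolding L2_set_def
  by (rule real_le_lsqrt) (use column_boundD[OF assms(1,3,4)] assms(2) in \<open>auto simp: power_mult_distrib sum_nonneg\<close>)

lemma column_bound_mono: "column_bound W c B \<Longrightarrow> V \<subseteq> W \<Longrightarrow> column_bound V c B"
  unfolding column_bound_def by blast

lemma word_series_summable: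
  fixes Y :: "'n \<Rightarrow> 't::{real_normed_vector, complete_space} \<Rightarrow>\<^sub>L 't"
  assumes upper: "row_upper Y r" and r: "0 \<le> r" "r < 1" and B: "column_bound W c B"
  shows "(\<lambda>\<gamma>. word_op Y \<gamma> (blinfun_apply (B \<gamma>) u)) summable_on W"
proof (rule square_dominated_summable)
  show "(\<lambda>\<gamma>. (norm (B \<gamma> u))\<^sup>2) summable_on W"
  proof (rule nonneg_bdd_above_summable_on)
    show "bdd_above (sum (\<lambda>\<gamma>. (norm (B \<gamma> u))\<^sup>2) ` {F. F \<subseteq> W \<and> finite F})"
      using column_boundD[OF B] by (intro bdd_aboveI[of _ "c\<^sup>2 * (norm u)\<^sup>2"]) auto
  qed simp
  have "r\<^sup>2 < 1"
    using r by (simp add: power_less_one_iff)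
  then show "0 \<le> 1 / (1 - r\<^sup>2)"
    by simp
  show "(norm (\<Sum>\<gamma>\<in>Z. word_op Y \<gamma> (B \<gamma> u)))\<^sup>2 \<le> 1 / (1 - r\<^sup>2) * (\<Sum>\<gamma>\<in>Z. (norm (B \<gamma> u))\<^sup>2)"
    if "finite Z" for Z
    using row_upper_words[OF upper r that, of 0] by simp
qed simp

lemma word_series_norm_le:
  fixes Y :: "'n \<Rightarrow> 't::real_normed_vector \<Rightarrow>\<^sub>L 't"
  assumes upper: "row_upper Y r" and r: "0 \<le> r" "r < 1" and B: "column_bound W c B" "0 \<le> c"
    and long: "\<And>\<gamma>. \<gamma> \<in> W \<Longrightarrow> k \<le> length \<gamma>"
    and s: "((\<lambda>\<gamma>. word_op Y \<gamma> (blinfun_apply (B \<gamma>) u)) has_sum s) W"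
  shows "norm s \<le> r ^ k / sqrt (1 - r\<^sup>2) * c * norm u"
proof (rule tendsto_upperbound)
  show "((\<lambda>Z. norm (\<Sum>\<gamma>\<in>Z. word_op Y \<gamma> (B \<gamma> u))) \<longlongrightarrow> norm s) (finite_subsets_at_top W)"
    using s unfolding has_sum_def by (rule tendsto_norm)
  show "\<forall>\<^sub>F Z in finite_subsets_at_top W.
      norm (\<Sum>\<gamma>\<in>Z. word_op Y \<gamma> (B \<gamma> u)) \<le> r ^ k / sqrt (1 - r\<^sup>2) * c * norm u"
  proof (rule eventually_finite_subsets_at_top_weakI)
    fix Z
    assume Z: "finite Z" "Z \<subseteq> W"
    have "r\<^sup>2 < 1"
      using r by (simp add: power_less_one_iff)
    have "norm (\<Sum>\<gamma>\<in>Z. word_op Y \<gamma> (B \<gamma> u))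
        \<le> r ^ k / sqrt (1 - r\<^sup>2) * L2_set (\<lambda>\<gamma>. norm (B \<gamma> u)) Z"
      by (rule row_upper_words_L2[OF upper r Z(1)]) (use Z(2) long in blast)
    also have "\<dots> \<le> r ^ k / sqrt (1 - r\<^sup>2) * (c * norm u)"
      by (intro mult_left_mono column_bound_L2[OF B Z]) (use r \<open>r\<^sup>2 < 1\<close> in simp)
    finally show "norm (\<Sum>\<gamma>\<in>Z. word_op Y \<gamma> (B \<gamma> u)) \<le> r ^ k / sqrt (1 - r\<^sup>2) * c * norm u"
      by (simp add: mult.assoc)
  qed
qed simp


section \<open>Word series in a tensor product\<close>

definition tensor_row ::
    "('h::chilbert_space \<Rightarrow> 'e::chilbert_space \<Rightarrow> 't::chilbert_space) \<Rightarrow>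
     ('n \<Rightarrow> 'h \<Rightarrow>\<^sub>L 'h) \<Rightarrow> 'n \<Rightarrow> 't \<Rightarrow>\<^sub>L 't"
  where "tensor_row ten X i = op_tensor ten (X i) id_blinfun"

lemma row_norm_nonneg: "0 \<le> row_norm X"
  by (simp add: row_norm_def)

lemma tensor_row_upper:
  fixes X :: "'n::countable \<Rightarrow> 'h::chilbert_space \<Rightarrow>\<^sub>L 'h"
  assumes tensor: "hilbert_tensor ten" and X: "X \<in> row_cball r"
  shows "row_upper (tensor_row ten X) r"
  unfolding row_upper_def tensor_row_def
proof (intro allI impI)
  fix I :: "'n set" and v
  assume I: "finite I"
  have X': "X \<in> row_tuples" "row_norm X \<le> r"
    using X by (simp_all add: row_cball_def)
  have "0 \<le> -1 * (norm (\<Sum>i\<in>I. op_tensor ten (X i) id_blinfun (v i)))\<^sup>2 + r\<^sup>2 * (\<Sum>i\<in>I. (norm (v i))\<^sup>2)"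
    by (rule row_estimate_tensor[OF tensor _ I])
      (use row_upper_estimate[OF X' I] X'(1) in \<open>simp_all add: row_tuples_def\<close>)
  then show "(norm (\<Sum>i\<in>I. op_tensor ten (X i) id_blinfun (v i)))\<^sup>2 \<le> r\<^sup>2 * (\<Sum>i\<in>I. (norm (v i))\<^sup>2)"
    by simp
qed

lemma tensor_row_lower:
  fixes X :: "'n::countable \<Rightarrow> 'h::chilbert_space \<Rightarrow>\<^sub>L 'h"
  assumes tensor: "hilbert_tensor ten" and X: "X \<in> row_tuples" "row_bounded_below X"
  shows "\<exists>C>0. row_lower (tensor_row ten X) C"
proof -
  obtain C where C: "C > 0"
    "\<And>I y. finite I \<Longrightarrow> C\<^sup>2 * (\<Sum>i\<in>I. (norm (y i))\<^sup>2) \<le> (norm (\<Sum>i\<in>I. X i (y i)))\<^sup>2"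
    using row_lower_estimate[OF X(2)] by blast
  have "C\<^sup>2 * (\<Sum>i\<in>I. (norm (v i))\<^sup>2) \<le> (norm (\<Sum>i\<in>I. op_tensor ten (X i) id_blinfun (v i)))\<^sup>2"
    if I: "finite I" for I v
  proof -
    have "0 \<le> 1 * (norm (\<Sum>i\<in>I. op_tensor ten (X i) id_blinfun (v i)))\<^sup>2
        + (- C\<^sup>2) * (\<Sum>i\<in>I. (norm (v i))\<^sup>2)"
      by (rule row_estimate_tensor[OF tensor _ I])
        (use C(2)[OF I] X(1) in \<open>simp_all add: row_tuples_def\<close>)
    then show ?thesis
      by simp
  qed
  then show ?thesis
    using C(1) by (auto simp: row_lower_def tensor_row_def)
qed

lemma word_op_cblin: "(\<And>i. X i \<in> cblin) \<Longrightarrow> word_op X \<alpha> \<in> cblin"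
  by (induction \<alpha>) (simp_all add: cblin_compose)

lemma op_tensor_word:
  assumes tensor: "hilbert_tensor ten" and X: "\<And>i. X i \<in> cblin" and A: "A \<in> cblin"
  shows "op_tensor ten (word_op X \<alpha>) A = word_op (tensor_row ten X) \<alpha> o\<^sub>L op_tensor ten id_blinfun A"
proof -
  have "op_tensor ten (word_op X \<alpha>) id_blinfun = word_op (tensor_row ten X) \<alpha>"
    by (induction \<alpha>)
      (simp_all add: op_tensor_id[OF tensor] op_tensor_compose[OF tensor] X word_op_cblin tensor_row_def)
  then show ?thesis
    by (simp add: op_tensor_split[OF tensor word_op_cblin[OF X] A])
qed

lemma column_bound_tensor:
  assumes tensor: "hilbert_tensor ten" and a: "\<And>\<alpha>. a \<alpha> \<in> cblin" and bound: "column_bound W c a"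
  shows "column_bound W c (\<lambda>\<alpha>. op_tensor ten id_blinfun (a \<alpha>))"
  unfolding column_bound_def
  by (intro allI impI column_estimate_tensor[OF tensor] a column_boundD[OF bound])

lemma linear_has_sum_operator:
  fixes T :: "'i \<Rightarrow> 'a::real_normed_vector \<Rightarrow>\<^sub>L 'b::real_normed_vector"
  assumes sums: "\<And>u. ((\<lambda>i. T i u) has_sum s u) W" and bound: "\<And>u. norm (s u) \<le> K * norm u"
  shows "blinfun_apply (Blinfun s) u = s u"
proof -
  have "bounded_linear s"
  proof (rule bounded_linear_intro)
    show "s (u + v) = s u + s v" for u v
      using has_sum_add[OF sums sums] sums[of "u + v"]
      by (auto simp: blinfun.add_right intro: has_sum_unique)
    show "s (r *\<^sub>R u) = r *\<^sub>R s u" for r u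
      using has_sum_bounded_linear[OF bounded_linear_scaleR_right sums] sums[of "r *\<^sub>R u"]
      by (auto simp: blinfun.scaleR_right intro: has_sum_unique)
    show "norm (s u) \<le> norm u * K" for u
      using bound by (simp add: mult.commute)
  qed
  then show ?thesis
    by (simp add: bounded_linear_Blinfun_apply)
qed

lemma geometric_tail_tendsto_0:
  fixes r :: real
  assumes r: "0 \<le> r" "r < 1"
  shows "(\<lambda>K. r ^ K / sqrt (1 - r\<^sup>2) * c) \<longlonglongrightarrow> 0"
proof -
  have "(\<lambda>K. r ^ K * (c / sqrt (1 - r\<^sup>2))) \<longlonglongrightarrow> 0 * (c / sqrt (1 - r\<^sup>2))"
    by (intro tendsto_intros LIMSEQ_power_zero) (use r in simp)
  then show ?thesis
    by simp
qed

text \<open>The partial sums by degree differ from the unconditional sum over all words by a tail of geometric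
  norm. Hence convergence of the homogeneous parts in operator norm and strong convergence over all
  words determine the same operator.\<close>

text \<open>A column bound on the coefficients makes the series over all words converge, with a geometric
  estimate for its tails.\<close>

context
  fixes ten :: "'h::chilbert_space \<Rightarrow> 'e::chilbert_space \<Rightarrow> 't::chilbert_space"
    and a :: "'n::countable list \<Rightarrow> 'e \<Rightarrow>\<^sub>L 'e" and X :: "'n \<Rightarrow> 'h \<Rightarrow>\<^sub>L 'h" and r :: real
  assumes tensor: "hilbert_tensor ten" and a: "\<And>\<alpha>. a \<alpha> \<in> cblin"
    and X: "X \<in> row_cball r" and r: "0 \<le> r" "r < 1"
begin

text \<open>The series is the row of the words in \<open>X\<^sub>i \<otimes> 1\<close> applied to the column of the \<open>1 \<otimes> A\<^sub>\<alpha>\<close>, so the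
  estimates for words apply to it.\<close>

lemma free_series_term:
  "op_tensor ten (word_op X \<alpha>) (a \<alpha>) u
    = word_op (tensor_row ten X) \<alpha> (op_tensor ten id_blinfun (a \<alpha>) u)"
proof -
  have "X i \<in> cblin" for i
    using X by (simp add: row_cball_def row_tuples_def)
  then show ?thesis
    by (simp add: op_tensor_word[OF tensor _ a])
qed

lemma free_series_summable:
  assumes "column_bound W c a"
  shows "(\<lambda>\<alpha>. op_tensor ten (word_op X \<alpha>) (a \<alpha>) u) summable_on W"
  unfolding free_series_term
  by (rule word_series_summable[OF tensor_row_upper[OF tensor X] r column_bound_tensor[OF tensor a assms]])

lemma free_series_norm_le:
  assumes "column_bound W c a" "0 \<le> c" "\<And>\<alpha>. \<alpha> \<in> W \<Longrightarrow> k \<le> length \<alpha>"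
    and "((\<lambda>\<alpha>. op_tensor ten (word_op X \<alpha>) (a \<alpha>) u) has_sum s) W"
  shows "norm s \<le> r ^ k / sqrt (1 - r\<^sup>2) * c * norm u"
  by (rule word_series_norm_le[OF tensor_row_upper[OF tensor X] r
        column_bound_tensor[OF tensor a assms(1)] assms(2,3) assms(4)[unfolded free_series_term]])

lemma free_series_operator:
  assumes "column_bound W c a" "0 \<le> c"
  obtains T :: "'t \<Rightarrow>\<^sub>L 't"
  where "\<And>u. ((\<lambda>\<alpha>. op_tensor ten (word_op X \<alpha>) (a \<alpha>) u) has_sum T u) W"
proof -
  define s where "s u = (\<Sum>\<^sub>\<infinity>\<alpha>\<in>W. op_tensor ten (word_op X \<alpha>) (a \<alpha>) u)" for u
  have s: "((\<lambda>\<alpha>. op_tensor ten (word_op X \<alpha>) (a \<alpha>) u) has_sum s u) W" for u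
    unfolding s_def by (rule has_sum_infsum[OF free_series_summable[OF assms(1)]])
  have "norm (s u) \<le> r ^ 0 / sqrt (1 - r\<^sup>2) * c * norm u" for u
    by (rule free_series_norm_le[OF assms _ s]) simp
  then have "Blinfun s u = s u" for u
    by (rule linear_has_sum_operator[OF s])
  then show thesis
    using that[of "Blinfun s"] s by simp
qed

lemma homogeneous_partial_sum:
  assumes P: "\<And>k. ((\<lambda>\<alpha>. op_tensor ten (word_op X \<alpha>) (a \<alpha>) u) has_sum p k) {\<alpha>. length \<alpha> = k}"
  shows "((\<lambda>\<alpha>. op_tensor ten (word_op X \<alpha>) (a \<alpha>) u) has_sum (\<Sum>k<K. p k)) {\<alpha>. length \<alpha> < K}"
proof (induction K)
  case (Suc K)
  have "{\<alpha>::'n list. length \<alpha> < Suc K} = {\<alpha>. length \<alpha> < K} \<union> {\<alpha>. length \<alpha> = K}"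
    by auto
  moreover have "((\<lambda>\<alpha>. op_tensor ten (word_op X \<alpha>) (a \<alpha>) u) has_sum ((\<Sum>k<K. p k) + p K))
      ({\<alpha>. length \<alpha> < K} \<union> {\<alpha>. length \<alpha> = K})"
    by (rule has_sum_Un_disjoint[OF Suc P]) auto
  ultimately show ?case
    by (simp only: sum.lessThan_Suc)
qed simp

lemma homogeneous_tail_le:
  assumes bound: "column_bound UNIV c a" "0 \<le> c"
    and P: "\<And>k. ((\<lambda>\<alpha>. op_tensor ten (word_op X \<alpha>) (a \<alpha>) u) has_sum p k) {\<alpha>. length \<alpha> = k}"
    and s: "((\<lambda>\<alpha>. op_tensor ten (word_op X \<alpha>) (a \<alpha>) u) has_sum s) UNIV"
  shows "norm ((\<Sum>k<K. p k) - s) \<le> r ^ K / sqrt (1 - r\<^sup>2) * c * norm u"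
proof -
  have tail: "column_bound {\<alpha>. K \<le> length \<alpha>} c a"
    using bound(1) by (rule column_bound_mono) simp
  obtain t where t: "((\<lambda>\<alpha>. op_tensor ten (word_op X \<alpha>) (a \<alpha>) u) has_sum t) {\<alpha>. K \<le> length \<alpha>}"
    using free_series_summable[OF tail] summable_on_def by blast
  have "((\<lambda>\<alpha>. op_tensor ten (word_op X \<alpha>) (a \<alpha>) u) has_sum ((\<Sum>k<K. p k) + t))
      ({\<alpha>. length \<alpha> < K} \<union> {\<alpha>. K \<le> length \<alpha>})"
    by (rule has_sum_Un_disjoint[OF homogeneous_partial_sum[OF P] t]) auto
  moreover have "{\<alpha>::'n list. length \<alpha> < K} \<union> {\<alpha>. K \<le> length \<alpha>} = UNIV"
    by auto
  ultimately have "s = (\<Sum>k<K. p k) + t"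
    using s has_sum_unique by metis
  moreover have "norm t \<le> r ^ K / sqrt (1 - r\<^sup>2) * c * norm u"
    by (rule free_series_norm_le[OF tail bound(2) _ t]) simp
  ultimately show ?thesis
    by simp
qed

lemma homogeneous_sums_iff:
  assumes bound: "column_bound UNIV c a" "0 \<le> c"
    and P: "\<And>k u. ((\<lambda>\<alpha>. op_tensor ten (word_op X \<alpha>) (a \<alpha>) u) has_sum blinfun_apply (P k) u) {\<alpha>. length \<alpha> = k}"
  shows "P sums T \<longleftrightarrow> (\<forall>u. ((\<lambda>\<alpha>. op_tensor ten (word_op X \<alpha>) (a \<alpha>) u) has_sum blinfun_apply T u) UNIV)"
proof -
  obtain S :: "'t \<Rightarrow>\<^sub>L 't"
    where S: "\<And>u. ((\<lambda>\<alpha>. op_tensor ten (word_op X \<alpha>) (a \<alpha>) u) has_sum S u) UNIV"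
    using free_series_operator[OF bound] by blast
  have "norm ((\<Sum>k<K. P k) - S) \<le> r ^ K / sqrt (1 - r\<^sup>2) * c" for K
  proof (rule norm_blinfun_bound)
    have "r\<^sup>2 < 1"
      using r by (simp add: power_less_one_iff)
    then show "0 \<le> r ^ K / sqrt (1 - r\<^sup>2) * c"
      using r bound(2) by simp
    show "norm (((\<Sum>k<K. P k) - S) u) \<le> r ^ K / sqrt (1 - r\<^sup>2) * c * norm u" for u
      using homogeneous_tail_le[OF bound P S, of u K] by (simp add: blinfun.diff_left blinfun.sum_left)
  qed
  then have "(\<lambda>K. (\<Sum>k<K. P k) - S) \<longlonglongrightarrow> 0"
    by (intro Lim_null_comparison[OF _ geometric_tail_tendsto_0[OF r, of c]] always_eventually) simp
  then have "P sums S"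
    by (simp add: sums_def LIM_zero_iff)
  then have "P sums T \<longleftrightarrow> T = S"
    using sums_unique2 by blast
  also have "\<dots> \<longleftrightarrow> (\<forall>u. T u = S u)"
    by (auto intro: blinfun_eqI)
  also have "\<dots> \<longleftrightarrow> (\<forall>u. ((\<lambda>\<alpha>. op_tensor ten (word_op X \<alpha>) (a \<alpha>) u) has_sum blinfun_apply T u) UNIV)"
  proof -
    have "T u = S u \<longleftrightarrow> ((\<lambda>\<alpha>. op_tensor ten (word_op X \<alpha>) (a \<alpha>) u) has_sum T u) UNIV" for u
      using S[of u] has_sum_unique[OF S[of u], of "T u"] by auto
    then show ?thesis
      by simp
  qed
  finally show ?thesis .
qed

end

lemma row_ball_imp_row_cball: "X \<in> row_ball 1 \<Longrightarrow> X \<in> row_cball (row_norm X) \<and> row_norm X < 1"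
  by (simp add: row_ball_def row_cball_def)

lemma free_holomorphicI:
  fixes ten :: "'h::chilbert_space \<Rightarrow> 'e::chilbert_space \<Rightarrow> 't::chilbert_space"
    and a :: "'n::countable list \<Rightarrow> 'e \<Rightarrow>\<^sub>L 'e"
  assumes tensor: "hilbert_tensor ten" and a: "\<And>\<alpha>. a \<alpha> \<in> cblin"
    and bound: "column_bound UNIV c a" "0 \<le> c"
    and G: "\<And>X u. X \<in> row_ball 1 \<Longrightarrow>
      ((\<lambda>\<alpha>. op_tensor ten (word_op X \<alpha>) (a \<alpha>) u) has_sum blinfun_apply (G X) u) UNIV"
  shows "free_holomorphic ten G"
  unfolding free_holomorphic_def
proof (intro exI[of _ a] conjI allI ballI a)
  fix X :: "'n \<Rightarrow> 'h \<Rightarrow>\<^sub>L 'h"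
  assume X: "X \<in> row_ball 1"
  note X' = conjunct1[OF row_ball_imp_row_cball[OF X]] row_norm_nonneg
    conjunct2[OF row_ball_imp_row_cball[OF X]]
  have "\<exists>T :: 't \<Rightarrow>\<^sub>L 't. \<forall>u. ((\<lambda>\<alpha>. op_tensor ten (word_op X \<alpha>) (a \<alpha>) u) has_sum T u) {\<alpha>. length \<alpha> = k}" for k
    using free_series_operator[OF tensor a X' column_bound_mono[OF bound(1)] bound(2)] by blast
  then obtain P :: "nat \<Rightarrow> 't \<Rightarrow>\<^sub>L 't" where
    P: "\<And>k u. ((\<lambda>\<alpha>. op_tensor ten (word_op X \<alpha>) (a \<alpha>) u) has_sum P k u) {\<alpha>. length \<alpha> = k}"
    by metis
  have "P sums G X"
    using homogeneous_sums_iff[OF tensor a X' bound P] G[OF X] by blast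
  then show "\<exists>P. (\<forall>k u. ((\<lambda>\<alpha>. op_tensor ten (word_op X \<alpha>) (a \<alpha>) u) has_sum blinfun_apply (P k) u)
      {\<alpha>. length \<alpha> = k}) \<and> P sums G X"
    using P by blast
qed


section \<open>Coefficient bounds from truncated shifts\<close>

lift_definition rank_one :: "'a::complex_inner \<Rightarrow> 'b::complex_inner \<Rightarrow> 'a \<Rightarrow>\<^sub>L 'b"
  is "\<lambda>a b x. cinner x a *\<^sub>C b"
proof -
  fix a :: 'a and b :: 'b
  show "bounded_linear (\<lambda>x. cinner x a *\<^sub>C b)"
  proof (rule bounded_linear_intro[where K = "norm a * norm b"])
    show "norm (cinner x a *\<^sub>C b) \<le> norm x * (norm a * norm b)" for x
      using mult_right_mono[OF cauchy_schwarz[of x a] norm_ge_zero[of b]]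
      by (simp add: norm_scaleC mult.assoc)
  qed (simp_all add: cinner_add_left scaleC_add_left cinner_scaleC_left scaleR_scaleC scaleC_scaleC)
qed

text \<open>If \<open>e\<close> is orthonormal on \<open>V\<close> and \<open>V\<close> is closed under removing the first letter, these are the
  left creation operators of the full Fock space, scaled by \<open>r\<close> and compressed to the span of the
  vectors \<open>e\<^sub>\<beta>\<close> with \<open>\<beta> \<in> V\<close>.\<close>

definition truncated_shift ::
    "('n list \<Rightarrow> 'h::complex_inner) \<Rightarrow> 'n list set \<Rightarrow> real \<Rightarrow> 'n \<Rightarrow> 'h \<Rightarrow>\<^sub>L 'h"
  where "truncated_shift e V r i = r *\<^sub>R (\<Sum>\<beta>\<in>(#) i -` V. rank_one (e \<beta>) (e (i # \<beta>)))"

lemma truncated_shift_apply: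
  "truncated_shift e V r i x = r *\<^sub>R (\<Sum>\<beta>\<in>(#) i -` V. cinner x (e \<beta>) *\<^sub>C e (i # \<beta>))"
  by (simp add: truncated_shift_def blinfun.scaleR_left blinfun.sum_left rank_one.rep_eq)

context
  fixes e :: "'n::countable list \<Rightarrow> 'h::chilbert_space" and V :: "'n list set" and r :: real
  assumes e: "orthonormal V e" and V: "finite V" "\<And>i \<beta>. i # \<beta> \<in> V \<Longrightarrow> \<beta> \<in> V" "[] \<in> V"
    and r: "0 \<le> r" "r < 1"
begin

lemma truncated_shift_basis:
  assumes "\<beta> \<in> V"
  shows "truncated_shift e V r i (e \<beta>) = (if i # \<beta> \<in> V then r *\<^sub>R e (i # \<beta>) else 0)"
proof -
  have "(\<Sum>\<beta>'\<in>(#) i -` V. cinner (e \<beta>) (e \<beta>') *\<^sub>C e (i # \<beta>'))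
    = (\<Sum>\<beta>'\<in>(#) i -` V. if \<beta>' = \<beta> then e (i # \<beta>) else 0)"
    using e assms V(2) by (intro sum.cong) (auto simp: orthonormal_def scaleC_one)
  then show ?thesis
    by (simp add: truncated_shift_apply finite_vimageI V(1))
qed

lemma word_op_truncated_shift:
  "word_op (truncated_shift e V r) \<alpha> (e []) = (if \<alpha> \<in> V then r ^ length \<alpha> *\<^sub>R e \<alpha> else 0)"
proof (induction \<alpha>)
  case (Cons i \<alpha>)
  show ?case
  proof (cases "\<alpha> \<in> V")
    case True
    then show ?thesis
      by (simp add: Cons blinfun.scaleR_right truncated_shift_basis)
  next
    case False
    then have "i # \<alpha> \<notin> V"
      using V(2) by blast
    then show ?thesis
      using False by (simp add: Cons blinfun.zero_right)
  qed
qed (simp add: V(3))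

lemma truncated_shift_cblin: "truncated_shift e V r i \<in> cblin"
  by (simp add: cblin_def truncated_shift_apply cinner_scaleC_left scaleC_scaleR scaleC_sum_right scaleC_scaleC)

lemma truncated_shift_adj:
  "adj (truncated_shift e V r i) = r *\<^sub>R (\<Sum>\<beta>\<in>(#) i -` V. rank_one (e (i # \<beta>)) (e \<beta>))"
proof (rule adj_eqI)
  have "cnj (cinner y z) = cinner z y" for y z :: 'h
    by (metis cinner_commute)
  then show "cinner (truncated_shift e V r i x) y
    = cinner x ((r *\<^sub>R (\<Sum>\<beta>\<in>(#) i -` V. rank_one (e (i # \<beta>)) (e \<beta>))) y)" for x y
    by (simp add: truncated_shift_apply blinfun.scaleR_left blinfun.sum_left rank_one.rep_eq
        cinner_scaleR_left cinner_scaleR_right cinner_sum_left cinner_sum_right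
        cinner_scaleC_left cinner_scaleC_right mult.commute)
qed

text \<open>The operators map distinct basis vectors to multiples of distinct basis vectors, so the sum of
  the \<open>X\<^sub>i X\<^sub>i\<^sup>*\<close> is \<open>r\<^sup>2\<close> times a projection.\<close>

lemma truncated_shift_in_row_ball: "truncated_shift e V r \<in> row_ball 1"
proof -
  define X where "X = truncated_shift e V r"
  define Z where "Z = V - {[]}"
  define G where "G = r\<^sup>2 *\<^sub>R (\<Sum>\<gamma>\<in>Z. rank_one (e \<gamma>) (e \<gamma>))"
  have Z: "finite Z" "[] \<notin> Z" "orthonormal Z e"
    using V(1) orthonormal_mono[OF e] by (auto simp: Z_def)
  have XX: "(X i o\<^sub>L adj (X i)) h = (\<Sum>\<beta>\<in>(#) i -` Z. r\<^sup>2 *\<^sub>R (cinner h (e (i # \<beta>)) *\<^sub>C e (i # \<beta>)))" for i h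
  proof -
    have sub: "(#) i -` V \<subseteq> V" "(#) i -` Z = (#) i -` V"
      using V(2) by (auto simp: Z_def)
    have "cinner (adj (X i) h) (e \<beta>) = of_real r * cinner h (e (i # \<beta>))" if "\<beta> \<in> (#) i -` V" for \<beta>
      unfolding X_def truncated_shift_adj
      using orthonormal_coefficient[OF orthonormal_mono[OF e sub(1)] _ that] V(1)
      by (simp add: blinfun.scaleR_left blinfun.sum_left rank_one.rep_eq cinner_scaleR_left
          finite_vimageI)
    then have "X i (adj (X i) h)
        = r *\<^sub>R (\<Sum>\<beta>\<in>(#) i -` V. (of_real r * cinner h (e (i # \<beta>))) *\<^sub>C e (i # \<beta>))"
      unfolding X_def truncated_shift_apply by (intro arg_cong[where f = "\<lambda>x. r *\<^sub>R x"] sum.cong) auto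
    then show ?thesis
      by (simp add: sub(2) scaleC_sum_right power2_eq_square scaleR_scaleC scaleC_scaleC mult.assoc)
  qed
  have "has_row_square X G"
    unfolding has_row_square_def
  proof
    fix h
    have J: "finite (hd ` Z)" "hd ` Z \<subseteq> hd ` Z"
      using Z(1) by auto
    have "G h = (\<Sum>\<gamma>\<in>Z. r\<^sup>2 *\<^sub>R (cinner h (e \<gamma>) *\<^sub>C e \<gamma>))"
      by (simp add: G_def blinfun.scaleR_left blinfun.sum_left rank_one.rep_eq scaleR_sum_right)
    also have "\<dots> = (\<Sum>i\<in>hd ` Z. (X i o\<^sub>L adj (X i)) h)"
      unfolding XX by (rule sum_by_first_letter[OF Z(1,2) J])
    finally have "((\<lambda>i. (X i o\<^sub>L adj (X i)) h) has_sum G h) (hd ` Z)"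
      using J(1) by (intro has_sum_finiteI)
    moreover have "(X i o\<^sub>L adj (X i)) h = 0" if "i \<notin> hd ` Z" for i
    proof -
      have "(#) i -` Z = {}"
        using that by force
      then show ?thesis
        by (simp only: XX sum.empty)
    qed
    ultimately show "((\<lambda>i. (X i o\<^sub>L adj (X i)) h) has_sum G h) UNIV"
      by (subst has_sum_cong_neutral[where T = "hd ` Z" and g = "\<lambda>i. (X i o\<^sub>L adj (X i)) h"]) auto
  qed
  moreover have "norm G \<le> r\<^sup>2"
  proof (rule norm_blinfun_bound)
    show "norm (G h) \<le> r\<^sup>2 * norm h" for h
      using bessel_inequality[OF Z(3,1), of h]
      by (simp add: G_def blinfun.scaleR_left blinfun.sum_left rank_one.rep_eq mult_left_mono)
  qed simp
  ultimately have "row_norm X < 1" "X \<in> row_tuples"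
    using r power_less_one_iff[of r 2] row_norm_eq[of X G] truncated_shift_cblin
    by (auto simp: row_tuples_def X_def)
  then show ?thesis
    by (simp add: row_ball_def X_def)
qed

end

text \<open>Evaluating on a truncated shift and at the vacuum vector separates the coefficients: the value
  is \<open>\<Sum> r\<^bsup>|\<alpha>|\<^esup> e\<^sub>\<alpha> \<otimes> A\<^sub>\<alpha> x\<close> with orthonormal \<open>e\<^sub>\<alpha>\<close>, and its norm is at most \<open>M \<parallel>x\<parallel>\<close>. Then \<open>r\<close> tends to \<open>1\<close>.\<close>

lemma coefficient_column_bound:
  fixes ten :: "'h::chilbert_space \<Rightarrow> 'e::chilbert_space \<Rightarrow> 't::chilbert_space"
    and F :: "('n::countable \<Rightarrow> 'h \<Rightarrow>\<^sub>L 'h) \<Rightarrow> ('t \<Rightarrow>\<^sub>L 't)"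
  assumes infinite_dimensional: "\<not> (\<exists>B :: 'h set. finite B \<and> cspan B = UNIV)"
    and tensor: "hilbert_tensor ten" and a: "\<And>\<alpha>. a \<alpha> \<in> cblin"
    and P: "\<And>X k u. X \<in> row_ball 1 \<Longrightarrow>
      ((\<lambda>\<alpha>. op_tensor ten (word_op X \<alpha>) (a \<alpha>) u) has_sum blinfun_apply (P X k) u) {\<alpha>. length \<alpha> = k}"
    and sums: "\<And>X. X \<in> row_ball 1 \<Longrightarrow> P X sums F X"
    and M: "\<And>X. X \<in> row_ball 1 \<Longrightarrow> norm (F X) \<le> M"
  shows "column_bound UNIV M a"
  unfolding column_bound_def
proof (intro allI impI)
  fix W :: "'n list set" and x
  assume W: "finite W"
  \<comment> \<open>The shifts reach \<open>e\<^sub>\<alpha>\<close> from \<open>e\<^bsub>[]\<^esub>\<close> through the suffixes of \<open>\<alpha>\<close>.\<close>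
  define V where "V = insert [] (\<Union>w\<in>W. (\<lambda>n. drop n w) ` {..length w})"
  have V: "finite V" "[] \<in> V" "W \<subseteq> V"
    using W by (auto simp: V_def intro!: image_eqI[where x = 0])
  have V_tl: "\<beta> \<in> V" if cons: "i # \<beta> \<in> V" for i \<beta>
  proof -
    obtain w n where w: "w \<in> W" "n \<le> length w" "i # \<beta> = drop n w"
      using cons by (auto simp: V_def)
    then have "\<beta> = drop (Suc n) w" "Suc n \<le> length w"
      by (metis drop_Suc list.sel(3) tl_drop, metis Suc_leI drop_all le_neq_implies_less list.distinct(1) nle_le)
    then show ?thesis
      using w(1) by (auto simp: V_def)
  qed
  obtain e :: "'n list \<Rightarrow> 'h" where e: "orthonormal V e"
    using orthonormal_family_exists[OF infinite_dimensional V(1)] by blast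
  have r_bound: "(\<Sum>\<alpha>\<in>W. (r ^ length \<alpha> * norm (a \<alpha> x))\<^sup>2) \<le> M\<^sup>2 * (norm x)\<^sup>2" if r: "0 \<le> r" "r < 1" for r
  proof -
    define X where "X = truncated_shift e V r"
    have X: "X \<in> row_ball 1"
      unfolding X_def by (rule truncated_shift_in_row_ball[OF e V(1) V_tl V(2) r])
    have Xc: "X i \<in> cblin" for i
      unfolding X_def by (rule truncated_shift_cblin[OF e V(1) V_tl V(2) r])
    define u where "u = ten (e []) x"
    have norm_e: "norm (e \<alpha>) = 1" if "\<alpha> \<in> V" for \<alpha>
      using e that by (simp add: orthonormal_def norm_eq_sqrt_cinner)
    define t where "t \<alpha> = ten (e \<alpha>) (r ^ length \<alpha> *\<^sub>R a \<alpha> x)" for \<alpha>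
    have term_eq: "op_tensor ten (word_op X \<alpha>) (a \<alpha>) u = (if \<alpha> \<in> V then t \<alpha> else 0)" for \<alpha>
      using word_op_truncated_shift[OF e V(1) V_tl V(2) r, where \<alpha> = \<alpha>]
      by (simp add: u_def t_def X_def[symmetric] op_tensor_ten[OF tensor word_op_cblin[OF Xc] a]
          ten_zero_left[OF tensor] scaleR_scaleC ten_scaleC_left[OF tensor] ten_scaleC_right[OF tensor])
    have P_eq: "P X k u = (\<Sum>\<alpha>\<in>{\<alpha> \<in> V. length \<alpha> = k}. t \<alpha>)" for k
    proof -
      have "((\<lambda>\<alpha>. op_tensor ten (word_op X \<alpha>) (a \<alpha>) u) has_sum (\<Sum>\<alpha>\<in>{\<alpha> \<in> V. length \<alpha> = k}. t \<alpha>))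
          {\<alpha>. length \<alpha> = k}"
        using has_sum_finite[of "{\<alpha> \<in> V. length \<alpha> = k}" t] V(1)
        by (subst has_sum_cong_neutral[where T = "{\<alpha> \<in> V. length \<alpha> = k}" and g = t]) (auto simp: term_eq)
      then show ?thesis
        using P[OF X] has_sum_unique by blast
    qed
    have "(\<lambda>k. P X k u) sums F X u"
      using bounded_linear.sums[OF blinfun.bounded_linear_left sums[OF X]] .
    moreover have "(\<lambda>k. P X k u) sums (\<Sum>k\<in>length ` V. P X k u)"
    proof (rule sums_finite)
      fix k
      assume "k \<notin> length ` V"
      then have "{\<alpha> \<in> V. length \<alpha> = k} = {}"
        by auto
      then show "P X k u = 0"
        unfolding P_eq by (simp only: sum.empty)
    qed (simp add: V(1))
    ultimately have "F X u = (\<Sum>k\<in>length ` V. P X k u)"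
      by (rule sums_unique2)
    also have "\<dots> = (\<Sum>\<alpha>\<in>V. t \<alpha>)"
      unfolding P_eq by (rule sum.group) (use V(1) in auto)
    finally have "(norm (F X u))\<^sup>2 = (\<Sum>\<alpha>\<in>V. (norm (r ^ length \<alpha> *\<^sub>R a \<alpha> x))\<^sup>2)"
      using norm_slices[OF hilbert_tensor_flip[OF tensor] V(1) e] by (simp add: t_def)
    then have "(\<Sum>\<alpha>\<in>V. (r ^ length \<alpha> * norm (a \<alpha> x))\<^sup>2) = (norm (F X u))\<^sup>2"
      using r by simp
    moreover have "norm (F X u) \<le> M * norm x"
    proof -
      have "norm (F X u) \<le> norm (F X) * norm u"
        by (rule norm_blinfun)
      also have "\<dots> \<le> M * norm u"
        by (intro mult_right_mono M[OF X]) simp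
      finally show ?thesis
        by (simp add: u_def norm_ten[OF tensor] norm_e V(2))
    qed
    then have "(norm (F X u))\<^sup>2 \<le> M\<^sup>2 * (norm x)\<^sup>2"
      using power_mono[of "norm (F X u)" "M * norm x" 2] by (simp add: power_mult_distrib)
    moreover have "(\<Sum>\<alpha>\<in>W. (r ^ length \<alpha> * norm (a \<alpha> x))\<^sup>2) \<le> (\<Sum>\<alpha>\<in>V. (r ^ length \<alpha> * norm (a \<alpha> x))\<^sup>2)"
      by (rule sum_mono2) (use V in auto)
    ultimately show ?thesis
      by simp
  qed
  define \<rho> where "\<rho> n = 1 - inverse (real (Suc n))" for n
  have rho: "0 \<le> \<rho> n" "\<rho> n < 1" for n
    by (simp_all add: \<rho>_def field_simps)
  have "\<rho> \<longlonglongrightarrow> 1 - 0"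
    unfolding \<rho>_def by (intro tendsto_intros LIMSEQ_inverse_real_of_nat)
  then have "(\<lambda>n. \<Sum>\<alpha>\<in>W. (\<rho> n ^ length \<alpha> * norm (a \<alpha> x))\<^sup>2)
      \<longlonglongrightarrow> (\<Sum>\<alpha>\<in>W. ((1 - 0) ^ length \<alpha> * norm (a \<alpha> x))\<^sup>2)"
    by (intro tendsto_intros)
  then show "(\<Sum>\<alpha>\<in>W. (norm (a \<alpha> x))\<^sup>2) \<le> M\<^sup>2 * (norm x)\<^sup>2"
    using LIMSEQ_le_const2 r_bound[OF rho] by fastforce
qed

lemma bounded_free_holomorphic:
  fixes ten :: "'h::chilbert_space \<Rightarrow> 'e::chilbert_space \<Rightarrow> 't::chilbert_space"
    and F :: "('n::countable \<Rightarrow> 'h \<Rightarrow>\<^sub>L 'h) \<Rightarrow> ('t \<Rightarrow>\<^sub>L 't)"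
  assumes infinite_dimensional: "\<not> (\<exists>B :: 'h set. finite B \<and> cspan B = UNIV)"
    and tensor: "hilbert_tensor ten" and F: "free_holomorphic ten F"
    and M: "0 \<le> M" "\<And>X. X \<in> row_ball 1 \<Longrightarrow> norm (F X) \<le> M"
  shows "\<exists>a. (\<forall>\<alpha>. a \<alpha> \<in> cblin) \<and> column_bound UNIV M a \<and>
    (\<forall>X\<in>row_ball 1. \<forall>u.
      ((\<lambda>\<alpha>. op_tensor ten (word_op X \<alpha>) (a \<alpha>) u) has_sum blinfun_apply (F X) u) UNIV)"
proof -
  obtain a where a: "\<And>\<alpha>. a \<alpha> \<in> cblin"
    and "\<forall>X\<in>row_ball 1. \<exists>P. (\<forall>k u. ((\<lambda>\<alpha>. op_tensor ten (word_op X \<alpha>) (a \<alpha>) u) has_sum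
      blinfun_apply (P k) u) {\<alpha>. length \<alpha> = k}) \<and> P sums F X"
    using F unfolding free_holomorphic_def by blast
  from bchoice[OF this(2)] obtain P where P: "\<And>X k u. X \<in> row_ball 1 \<Longrightarrow>
      ((\<lambda>\<alpha>. op_tensor ten (word_op X \<alpha>) (a \<alpha>) u) has_sum blinfun_apply (P X k) u) {\<alpha>. length \<alpha> = k}"
    and sums: "\<And>X. X \<in> row_ball 1 \<Longrightarrow> P X sums F X"
    by blast
  have bound: "column_bound UNIV M a"
    by (rule coefficient_column_bound[OF infinite_dimensional tensor a P sums M(2)])
  have "((\<lambda>\<alpha>. op_tensor ten (word_op X \<alpha>) (a \<alpha>) u) has_sum blinfun_apply (F X) u) UNIV"
    if X: "X \<in> row_ball 1" for X u
    using homogeneous_sums_iff[OF tensor a conjunct1[OF row_ball_imp_row_cball[OF X]] row_norm_nonneg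
        conjunct2[OF row_ball_imp_row_cball[OF X]] bound M(1) P[OF X]] sums[OF X]
    by blast
  then show ?thesis
    using a bound by blast
qed


section \<open>Convergence of the coefficients\<close>

text \<open>This makes the spaces of bounded operators complete, so that Cauchy sequences of coefficients
  converge.\<close>

subclass (in chilbert_space) banach ..

lemma column_boundI_L2:
  assumes "\<And>V x. finite V \<Longrightarrow> V \<subseteq> W \<Longrightarrow> L2_set (\<lambda>\<gamma>. norm (blinfun_apply (B \<gamma>) x)) V \<le> c * norm x"
  shows "column_bound W c B"
  unfolding column_bound_def
proof (intro allI impI)
  fix V x
  assume "finite V" "V \<subseteq> W"
  from power_mono[OF assms[OF this, of x] L2_set_nonneg, of 2]
  show "(\<Sum>\<gamma>\<in>V. (norm (B \<gamma> x))\<^sup>2) \<le> c\<^sup>2 * (norm x)\<^sup>2"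
    by (simp add: L2_set_def sum_nonneg power_mult_distrib)
qed

lemma column_bound_weaken:
  assumes "column_bound W c B" "0 \<le> c" "c \<le> c'"
  shows "column_bound W c' B"
proof (rule column_boundI_L2)
  fix V x
  assume "finite V" "V \<subseteq> W"
  then have "L2_set (\<lambda>\<gamma>. norm (B \<gamma> x)) V \<le> c * norm x"
    by (rule column_bound_L2[OF assms(1,2)])
  also have "\<dots> \<le> c' * norm x"
    by (intro mult_right_mono assms(3)) simp
  finally show "L2_set (\<lambda>\<gamma>. norm (B \<gamma> x)) V \<le> c' * norm x" .
qed

lemma column_bound_diff:
  assumes "column_bound W c B" "0 \<le> c" "column_bound W c' B'" "0 \<le> c'"
  shows "column_bound W (c + c') (\<lambda>\<gamma>. B \<gamma> - B' \<gamma>)"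
proof (rule column_boundI_L2)
  fix V x
  assume V: "finite V" "V \<subseteq> W"
  have "L2_set (\<lambda>\<gamma>. norm ((B \<gamma> - B' \<gamma>) x)) V \<le> L2_set (\<lambda>\<gamma>. norm (B \<gamma> x) + norm (B' \<gamma> x)) V"
    by (intro L2_set_mono) (simp_all add: blinfun.diff_left norm_triangle_ineq4)
  also have "\<dots> \<le> L2_set (\<lambda>\<gamma>. norm (B \<gamma> x)) V + L2_set (\<lambda>\<gamma>. norm (B' \<gamma> x)) V"
    by (rule L2_set_triangle_ineq)
  also have "\<dots> \<le> (c + c') * norm x"
    using column_bound_L2[OF assms(1,2) V, of x] column_bound_L2[OF assms(3,4) V, of x]
    by (simp add: distrib_right)
  finally show "L2_set (\<lambda>\<gamma>. norm ((B \<gamma> - B' \<gamma>) x)) V \<le> (c + c') * norm x" .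
qed

lemma column_bound_Un:
  assumes "column_bound W c B" "0 \<le> c" "column_bound W' c' B" "0 \<le> c'"
  shows "column_bound (W \<union> W') (c + c') B"
  unfolding column_bound_def
proof (intro allI impI)
  fix V x
  assume V: "finite V" "V \<subseteq> W \<union> W'"
  have "(\<Sum>\<gamma>\<in>V. (norm (B \<gamma> x))\<^sup>2) = (\<Sum>\<gamma>\<in>V \<inter> W. (norm (B \<gamma> x))\<^sup>2) + (\<Sum>\<gamma>\<in>V - W. (norm (B \<gamma> x))\<^sup>2)"
    by (rule sum.Int_Diff[OF V(1)])
  also have "\<dots> \<le> c\<^sup>2 * (norm x)\<^sup>2 + c'\<^sup>2 * (norm x)\<^sup>2"
    by (intro add_mono column_boundD[OF assms(1)] column_boundD[OF assms(3)]) (use V in auto)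
  also have "\<dots> \<le> (c + c')\<^sup>2 * (norm x)\<^sup>2"
    using assms(2,4) by (simp add: power2_sum flip: distrib_right)
      (intro mult_right_mono, simp_all)
  finally show "(\<Sum>\<gamma>\<in>V. (norm (B \<gamma> x))\<^sup>2) \<le> (c + c')\<^sup>2 * (norm x)\<^sup>2" .
qed

lemma column_bound_norm_le:
  assumes "column_bound W c B" "0 \<le> c" "\<gamma> \<in> W"
  shows "norm (B \<gamma>) \<le> c"
  by (rule norm_blinfun_bound) (use column_bound_L2[OF assms(1,2), of "{\<gamma>}"] assms(2,3) in auto)

lemma column_bound_limit:
  assumes bound: "\<And>j. N \<le> j \<Longrightarrow> column_bound W c (b j)" and lim: "\<And>\<gamma>. (\<lambda>j. b j \<gamma>) \<longlonglongrightarrow> b' \<gamma>"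
  shows "column_bound W c b'"
  unfolding column_bound_def
proof (intro allI impI)
  fix V x
  assume V: "finite V" "V \<subseteq> W"
  have "(\<lambda>j. \<Sum>\<gamma>\<in>V. (norm (b j \<gamma> x))\<^sup>2) \<longlonglongrightarrow> (\<Sum>\<gamma>\<in>V. (norm (b' \<gamma> x))\<^sup>2)"
    by (intro tendsto_intros blinfun.tendsto lim)
  then show "(\<Sum>\<gamma>\<in>V. (norm (b' \<gamma> x))\<^sup>2) \<le> c\<^sup>2 * (norm x)\<^sup>2"
    by (rule LIMSEQ_le_const2) (use column_boundD[OF bound V] in blast)
qed

lemma cblin_limit:
  assumes T: "\<And>j. T j \<in> cblin" and lim: "T \<longlonglongrightarrow> S"
  shows "S \<in> cblin"
proof -
  have "S (c *\<^sub>C x) = c *\<^sub>C S x" for c x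
  proof (rule LIMSEQ_unique)
    show "(\<lambda>j. T j (c *\<^sub>C x)) \<longlonglongrightarrow> S (c *\<^sub>C x)"
      by (intro blinfun.tendsto lim tendsto_const)
    have "bounded_linear (\<lambda>y. c *\<^sub>C (y::'b))"
      by (rule bounded_linear_intro[where K = "cmod c"])
        (simp_all add: scaleC_add_right scaleC_scaleR norm_scaleC mult.commute)
    then have "(\<lambda>j. c *\<^sub>C T j x) \<longlonglongrightarrow> c *\<^sub>C S x"
      by (rule bounded_linear.tendsto) (intro blinfun.tendsto lim tendsto_const)
    then show "(\<lambda>j. T j (c *\<^sub>C x)) \<longlonglongrightarrow> c *\<^sub>C S x"
      using T by (simp add: cblin_def)
  qed
  then show ?thesis
    by (simp add: cblin_def)
qed

lemma series_diff:
  assumes tensor: "hilbert_tensor ten" and a: "\<And>\<alpha>. a \<alpha> \<in> cblin" and b: "\<And>\<alpha>. b \<alpha> \<in> cblin"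
    and X: "X \<in> row_cball r" "0 \<le> r" "r < 1"
    and "((\<lambda>\<alpha>. op_tensor ten (word_op X \<alpha>) (a \<alpha>) u) has_sum blinfun_apply S u) UNIV"
    and "((\<lambda>\<alpha>. op_tensor ten (word_op X \<alpha>) (b \<alpha>) u) has_sum blinfun_apply T u) UNIV"
  shows "((\<lambda>\<alpha>. op_tensor ten (word_op X \<alpha>) (a \<alpha> - b \<alpha>) u) has_sum blinfun_apply (S - T) u) UNIV"
proof -
  have "op_tensor ten (word_op X \<alpha>) (a \<alpha> - b \<alpha>) u
      = op_tensor ten (word_op X \<alpha>) (a \<alpha>) u - op_tensor ten (word_op X \<alpha>) (b \<alpha>) u" for \<alpha>
    using free_series_term[where a = a, OF tensor a X] free_series_term[where a = b, OF tensor b X]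
      free_series_term[where a = "\<lambda>\<alpha>. a \<alpha> - b \<alpha>", OF tensor cblin_diff[OF a b] X]
    by (simp add: op_tensor_diff[OF tensor a b] blinfun.diff_left blinfun.diff_right)
  moreover have neg: "((\<lambda>\<alpha>. - op_tensor ten (word_op X \<alpha>) (b \<alpha>) u) has_sum - T u) UNIV"
    using assms(8) by (simp add: has_sum_uminus)
  ultimately show ?thesis
    using has_sum_add[OF assms(7) neg] by (simp add: blinfun.diff_left)
qed

text \<open>At a point that is bounded below, the coefficients of length \<open>k\<close> are controlled by the value
  \<open>T\<close> of the series, by the coefficients of smaller length, and by a remainder from the
  longer words that vanishes with \<open>r\<close>.\<close>

lemma level_column_bound:
  fixes ten :: "'h::chilbert_space \<Rightarrow> 'e::chilbert_space \<Rightarrow> 't::chilbert_space"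
    and d :: "'n::countable list \<Rightarrow> 'e \<Rightarrow>\<^sub>L 'e" and X :: "'n \<Rightarrow> 'h \<Rightarrow>\<^sub>L 'h"
  assumes infinite_dimensional: "\<not> (\<exists>B :: 'h set. finite B \<and> cspan B = UNIV)"
    and tensor: "hilbert_tensor ten" and d: "\<And>\<alpha>. d \<alpha> \<in> cblin"
    and X: "X \<in> row_cball r" and r: "0 \<le> r" "r < 1"
    and lower: "row_lower (tensor_row ten X) C" "0 < C"
    and bound: "column_bound UNIV c d" "0 \<le> c"
    and low: "column_bound {\<alpha>. length \<alpha> < k} \<epsilon> d" "0 \<le> \<epsilon>"
    and T: "\<And>u. ((\<lambda>\<alpha>. op_tensor ten (word_op X \<alpha>) (d \<alpha>) u) has_sum blinfun_apply T u) UNIV"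
  shows "column_bound {\<alpha>. length \<alpha> = k}
    ((norm T + \<epsilon> / sqrt (1 - r\<^sup>2)) / C ^ k + r / sqrt (1 - r\<^sup>2) * c) d"
proof (rule column_boundI_L2)
  fix V :: "'n list set" and x
  assume V: "finite V" "V \<subseteq> {\<alpha>. length \<alpha> = k}"
  define \<kappa> where "\<kappa> = r / sqrt (1 - r\<^sup>2)"
  have "r\<^sup>2 < 1"
    using r by (simp add: power_less_one_iff)
  then have \<kappa>: "0 \<le> \<kappa>"
    using r by (simp add: \<kappa>_def)
  \<comment> \<open>The estimates in the tensor product are tested on \<open>e \<otimes> x\<close> with a unit vector \<open>e\<close>.\<close>
  obtain e :: "unit \<Rightarrow> 'h" where e: "orthonormal {()} e"
    using orthonormal_family_exists[OF infinite_dimensional, of "{()}"] by blast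
  then have norm_e: "norm (e ()) = 1"
    by (simp add: orthonormal_def norm_eq_sqrt_cinner)
  define u where "u = ten (e ()) x"
  define Y where "Y = tensor_row ten X"
  define w where "w \<alpha> = op_tensor ten id_blinfun (d \<alpha>) u" for \<alpha>
  have norm_w: "norm (w \<alpha>) = norm (d \<alpha> x)" for \<alpha>
    by (simp add: w_def u_def op_tensor_ten[OF tensor _ d] norm_ten[OF tensor] norm_e)
  have norm_u: "norm u = norm x"
    by (simp add: u_def norm_ten[OF tensor] norm_e)
  have series_term: "op_tensor ten (word_op X \<alpha>) (d \<alpha>) u = word_op Y \<alpha> (w \<alpha>)" for \<alpha>
    unfolding Y_def w_def by (rule free_series_term[OF tensor d X r])
  obtain s where s: "((\<lambda>\<alpha>. op_tensor ten (word_op X \<alpha>) (d \<alpha>) u) has_sum s) {\<alpha>. length \<alpha> < k}"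
    using free_series_summable[OF tensor d X r low(1)] summable_on_def by blast
  obtain t where t: "((\<lambda>\<alpha>. op_tensor ten (word_op X \<alpha>) (d \<alpha>) u) has_sum t) {\<alpha>. k \<le> length \<alpha>}"
    using free_series_summable[OF tensor d X r column_bound_mono[OF bound(1)]] summable_on_def by blast
  have "norm s \<le> r ^ 0 / sqrt (1 - r\<^sup>2) * \<epsilon> * norm u"
    by (rule free_series_norm_le[OF tensor d X r low _ s]) simp
  moreover have "T u = s + t"
  proof -
    have "((\<lambda>\<alpha>. op_tensor ten (word_op X \<alpha>) (d \<alpha>) u) has_sum (s + t))
        ({\<alpha>. length \<alpha> < k} \<union> {\<alpha>. k \<le> length \<alpha>})"
      by (rule has_sum_Un_disjoint[OF s t]) auto
    moreover have "{\<alpha>::'n list. length \<alpha> < k} \<union> {\<alpha>. k \<le> length \<alpha>} = UNIV"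
      by auto
    ultimately show ?thesis
      using T[of u] has_sum_unique by metis
  qed
  ultimately have norm_t: "norm t \<le> (norm T + \<epsilon> / sqrt (1 - r\<^sup>2)) * norm x"
    using norm_triangle_ineq4[of "T u" s] norm_blinfun[of T u]
    by (simp add: norm_u distrib_right)
  have "C ^ k * L2_set (\<lambda>\<alpha>. norm (d \<alpha> x)) V \<le> norm t + C ^ k * \<kappa> * (c * norm x)"
  proof (rule tendsto_lowerbound)
    show "((\<lambda>Z. norm (\<Sum>\<alpha>\<in>Z. word_op Y \<alpha> (w \<alpha>)) + C ^ k * \<kappa> * (c * norm x))
        \<longlongrightarrow> norm t + C ^ k * \<kappa> * (c * norm x)) (finite_subsets_at_top {\<alpha>. k \<le> length \<alpha>})"
      using t unfolding has_sum_def series_term by (intro tendsto_intros)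
    have "C ^ k * L2_set (\<lambda>\<alpha>. norm (d \<alpha> x)) V
        \<le> norm (\<Sum>\<alpha>\<in>Z. word_op Y \<alpha> (w \<alpha>)) + C ^ k * \<kappa> * (c * norm x)"
      if Z: "finite Z" "V \<subseteq> Z" "Z \<subseteq> {\<alpha>. k \<le> length \<alpha>}" for Z
    proof -
      have "L2_set (\<lambda>\<alpha>. norm (d \<alpha> x)) V \<le> L2_set (\<lambda>\<alpha>. norm (d \<alpha> x)) {\<alpha> \<in> Z. length \<alpha> = k}"
        unfolding L2_set_def by (intro real_sqrt_le_mono sum_mono2) (use Z V in auto)
      then have "C ^ k * L2_set (\<lambda>\<alpha>. norm (d \<alpha> x)) V
          \<le> C ^ k * L2_set (\<lambda>\<alpha>. norm (w \<alpha>)) {\<alpha> \<in> Z. length \<alpha> = k}"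
        unfolding norm_w by (rule mult_left_mono) (use lower(2) in simp)
      also have "\<dots> \<le> norm (\<Sum>\<alpha>\<in>Z. word_op Y \<alpha> (w \<alpha>)) + C ^ k * \<kappa> * L2_set (\<lambda>\<alpha>. norm (w \<alpha>)) Z"
        unfolding \<kappa>_def Y_def
        by (rule row_lower_words[OF tensor_row_upper[OF tensor X] r lower Z(1)]) (use Z(3) in blast)
      also have "\<dots> \<le> norm (\<Sum>\<alpha>\<in>Z. word_op Y \<alpha> (w \<alpha>)) + C ^ k * \<kappa> * (c * norm x)"
        unfolding norm_w
        by (intro add_left_mono mult_left_mono column_bound_L2[OF bound Z(1)])
          (use lower(2) \<kappa> in auto)
      finally show ?thesis .
    qed
    moreover have "V \<subseteq> {\<alpha>. k \<le> length \<alpha>}"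
      using V(2) by auto
    ultimately show "\<forall>\<^sub>F Z in finite_subsets_at_top {\<alpha>. k \<le> length \<alpha>}.
        C ^ k * L2_set (\<lambda>\<alpha>. norm (d \<alpha> x)) V
        \<le> norm (\<Sum>\<alpha>\<in>Z. word_op Y \<alpha> (w \<alpha>)) + C ^ k * \<kappa> * (c * norm x)"
      unfolding eventually_finite_subsets_at_top using V(1) by blast
  qed simp
  also have "\<dots> \<le> (norm T + \<epsilon> / sqrt (1 - r\<^sup>2)) * norm x + C ^ k * \<kappa> * (c * norm x)"
    using norm_t by simp
  also have "\<dots> = C ^ k * (((norm T + \<epsilon> / sqrt (1 - r\<^sup>2)) / C ^ k + \<kappa> * c) * norm x)"
    using lower(2) by (simp add: field_simps)
  finally show "L2_set (\<lambda>\<alpha>. norm (d \<alpha> x)) V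
      \<le> ((norm T + \<epsilon> / sqrt (1 - r\<^sup>2)) / C ^ k + r / sqrt (1 - r\<^sup>2) * c) * norm x"
    using lower(2) by (simp add: \<kappa>_def)
qed

text \<open>The remainder in the previous estimate is made small first, by the choice of one point \<open>A p\<close> of
  the null sequence; its lower bound \<open>C\<close> is then a fixed number, and the other two terms tend to
  zero as \<open>m\<close> and \<open>j\<close> grow.\<close>

lemma coefficients_Cauchy:
  fixes ten :: "'h::chilbert_space \<Rightarrow> 'e::chilbert_space \<Rightarrow> 't::chilbert_space"
    and F :: "nat \<Rightarrow> ('n::countable \<Rightarrow> 'h \<Rightarrow>\<^sub>L 'h) \<Rightarrow> ('t \<Rightarrow>\<^sub>L 't)"
    and A :: "nat \<Rightarrow> 'n \<Rightarrow> 'h \<Rightarrow>\<^sub>L 'h" and a :: "nat \<Rightarrow> 'n list \<Rightarrow> 'e \<Rightarrow>\<^sub>L 'e"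
  assumes infinite_dimensional: "\<not> (\<exists>B :: 'h set. finite B \<and> cspan B = UNIV)"
    and tensor: "hilbert_tensor ten" and a: "\<And>m \<alpha>. a m \<alpha> \<in> cblin"
    and bound: "\<And>m. column_bound UNIV M (a m)" "0 \<le> M"
    and series: "\<And>m X u. X \<in> row_ball 1 \<Longrightarrow>
      ((\<lambda>\<alpha>. op_tensor ten (word_op X \<alpha>) (a m \<alpha>) u) has_sum blinfun_apply (F m X) u) UNIV"
    and in_ball: "\<And>p. A p \<in> row_ball 1"
    and bounded_below: "\<And>p. row_bounded_below (A p)"
    and null_sequence: "(\<lambda>p. row_norm (A p)) \<longlonglongrightarrow> 0"
    and pointwise_limit: "\<And>p. convergent (\<lambda>m. F m (A p))"
    and "0 < \<epsilon>"
  shows "\<exists>N. \<forall>m\<ge>N. \<forall>j\<ge>N. column_bound {\<alpha>. length \<alpha> < k} \<epsilon> (\<lambda>\<alpha>. a m \<alpha> - a j \<alpha>)"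
  using \<open>0 < \<epsilon>\<close>
proof (induction k arbitrary: \<epsilon>)
  case 0
  show ?case
    by (simp add: column_bound_def)
next
  case (Suc k)
  have "(\<lambda>p. row_norm (A p) / sqrt (1 - (row_norm (A p))\<^sup>2) * (M + M)) \<longlonglongrightarrow> 0 / sqrt (1 - 0\<^sup>2) * (M + M)"
    by (intro tendsto_intros null_sequence) simp
  then have "\<forall>\<^sub>F p in sequentially. row_norm (A p) / sqrt (1 - (row_norm (A p))\<^sup>2) * (M + M) < \<epsilon> / 4"
    by (rule order_tendstoD(2)) (use Suc.prems in simp)
  then obtain p where p: "row_norm (A p) / sqrt (1 - (row_norm (A p))\<^sup>2) * (M + M) < \<epsilon> / 4"
    using eventually_sequentially by auto
  define X where "X = A p"
  define r where "r = row_norm X"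
  have X: "X \<in> row_ball 1" "X \<in> row_cball r" "0 \<le> r" "r < 1" "X \<in> row_tuples"
    using in_ball[of p] row_norm_nonneg by (simp_all add: X_def r_def row_ball_def row_cball_def)
  obtain C where C: "0 < C" "row_lower (tensor_row ten X) C"
    using tensor_row_lower[OF tensor X(5)] bounded_below by (auto simp: X_def)
  have "r\<^sup>2 < 1"
    using X(3,4) by (simp add: power_less_one_iff)
  then have sqrt_pos: "0 < sqrt (1 - r\<^sup>2)"
    by simp
  define \<delta> where "\<delta> = min (\<epsilon> / 2) (sqrt (1 - r\<^sup>2) * (C ^ k * (\<epsilon> / 8)))"
  have delta: "0 < \<delta>" "\<delta> \<le> \<epsilon> / 2" "\<delta> / sqrt (1 - r\<^sup>2) \<le> C ^ k * (\<epsilon> / 8)"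
    using Suc.prems C(1) sqrt_pos by (simp_all add: \<delta>_def pos_divide_le_eq mult.commute)
  obtain N\<^sub>1 where N1: "\<And>m j. N\<^sub>1 \<le> m \<Longrightarrow> N\<^sub>1 \<le> j \<Longrightarrow>
      column_bound {\<alpha>. length \<alpha> < k} \<delta> (\<lambda>\<alpha>. a m \<alpha> - a j \<alpha>)"
    using Suc.IH[OF delta(1)] by blast
  have "Cauchy (\<lambda>m. F m X)"
    unfolding X_def using pointwise_limit[of p] by (rule convergent_Cauchy)
  moreover have "0 < C ^ k * (\<epsilon> / 8)"
    using C(1) Suc.prems by simp
  ultimately obtain N\<^sub>2 where N2: "\<And>m j. N\<^sub>2 \<le> m \<Longrightarrow> N\<^sub>2 \<le> j \<Longrightarrow> norm (F m X - F j X) < C ^ k * (\<epsilon> / 8)"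
    using CauchyD by metis
  have "column_bound {\<alpha>. length \<alpha> < Suc k} \<epsilon> (\<lambda>\<alpha>. a m \<alpha> - a j \<alpha>)"
    if "max N\<^sub>1 N\<^sub>2 \<le> m" "max N\<^sub>1 N\<^sub>2 \<le> j" for m j
  proof -
    define d where "d \<alpha> = a m \<alpha> - a j \<alpha>" for \<alpha>
    define T where "T = F m X - F j X"
    have low: "column_bound {\<alpha>. length \<alpha> < k} \<delta> d"
      unfolding d_def using N1 that by simp
    have d: "d \<alpha> \<in> cblin" for \<alpha>
      by (simp add: d_def cblin_diff a)
    have d_bound: "column_bound UNIV (M + M) d"
      unfolding d_def by (rule column_bound_diff[OF bound bound])
    have d_series: "((\<lambda>\<alpha>. op_tensor ten (word_op X \<alpha>) (d \<alpha>) u) has_sum T u) UNIV" for u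
      unfolding T_def d_def by (rule series_diff[OF tensor a a X(2-4) series[OF X(1)] series[OF X(1)]])
    have level_raw: "column_bound {\<alpha>. length \<alpha> = k}
        ((norm T + \<delta> / sqrt (1 - r\<^sup>2)) / C ^ k + r / sqrt (1 - r\<^sup>2) * (M + M)) d"
      by (rule level_column_bound[OF infinite_dimensional tensor d X(2-4) C(2,1) d_bound _ low _ d_series])
        (use bound(2) delta(1) in auto)
    have le: "(norm T + \<delta> / sqrt (1 - r\<^sup>2)) / C ^ k + r / sqrt (1 - r\<^sup>2) * (M + M) \<le> \<epsilon> / 2"
    proof -
      have "norm T < C ^ k * (\<epsilon> / 8)"
        unfolding T_def using N2 that by simp
      then have "norm T + \<delta> / sqrt (1 - r\<^sup>2) \<le> C ^ k * (\<epsilon> / 8) + C ^ k * (\<epsilon> / 8)"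
        using delta(3) by linarith
      also have "\<dots> = C ^ k * (\<epsilon> / 4)"
        by (simp flip: distrib_left)
      finally have "(norm T + \<delta> / sqrt (1 - r\<^sup>2)) / C ^ k \<le> \<epsilon> / 4"
        using C(1) by (simp add: pos_divide_le_eq mult.commute)
      then show ?thesis
        using p unfolding r_def X_def by linarith
    qed
    have nonneg: "0 \<le> (norm T + \<delta> / sqrt (1 - r\<^sup>2)) / C ^ k + r / sqrt (1 - r\<^sup>2) * (M + M)"
      using C(1) X(3) bound(2) delta(1) sqrt_pos by simp
    have level: "column_bound {\<alpha>. length \<alpha> = k} (\<epsilon> / 2) d"
      by (rule column_bound_weaken[OF level_raw nonneg le])
    have "column_bound {\<alpha>. length \<alpha> < k} (\<epsilon> / 2) d"
      by (rule column_bound_weaken[OF low]) (use delta(1,2) in auto)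
    from column_bound_Un[OF this _ level] Suc.prems
    have "column_bound ({\<alpha>. length \<alpha> < k} \<union> {\<alpha>. length \<alpha> = k}) \<epsilon> d"
      by simp
    moreover have "{\<alpha>::'n list. length \<alpha> < k} \<union> {\<alpha>. length \<alpha> = k} = {\<alpha>. length \<alpha> < Suc k}"
      by auto
    ultimately show ?thesis
      by (simp add: d_def[abs_def])
  qed
  then show ?case
    by blast
qed


section \<open>Uniform convergence on smaller balls\<close>

text \<open>The limits of the coefficients define the limit function. On the ball of radius \<open>r\<close>, the words
  of length at least \<open>K\<close> contribute to \<open>F\<^sub>m - G\<close> a geometric tail, uniformly in \<open>m\<close>, and on the
  shorter words the coefficients converge in the column norm.\<close>

theorem theorem2p1:
  fixes ten :: "'h::chilbert_space \<Rightarrow> 'e::chilbert_space \<Rightarrow> 't::chilbert_space"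
    and F :: "nat \<Rightarrow> ('n::countable \<Rightarrow> 'h \<Rightarrow>\<^sub>L 'h) \<Rightarrow> ('t \<Rightarrow>\<^sub>L 't)"
    and A :: "nat \<Rightarrow> 'n \<Rightarrow> 'h \<Rightarrow>\<^sub>L 'h"
  assumes separable: "separable_space (euclidean :: 'h topology)"
    and infinite_dimensional: "\<not> (\<exists>B :: 'h set. finite B \<and> cspan B = UNIV)"
    and tensor: "hilbert_tensor ten"
    and holomorphic: "\<And>m. free_holomorphic ten (F m)"
    and uniformly_bounded: "\<exists>M>0. \<forall>m. \<forall>X \<in> row_ball 1. norm (F m X) \<le> M"
    and in_ball: "\<And>k. A k \<in> row_ball 1"
    and bounded_below: "\<And>k. row_bounded_below (A k)"
    and null_sequence: "(\<lambda>k. row_norm (A k)) \<longlonglongrightarrow> 0"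
    and pointwise_limit: "\<And>k. convergent (\<lambda>m. F m (A k))"
  shows "\<exists>G. free_holomorphic ten G \<and>
    (\<forall>r. 0 \<le> r \<and> r < 1 \<longrightarrow> uniform_limit (row_cball r) F G sequentially)"
proof -
  obtain M where M: "0 < M" "\<And>m X. X \<in> row_ball 1 \<Longrightarrow> norm (F m X) \<le> M"
    using uniformly_bounded by blast
  then have M0: "0 \<le> M"
    by simp
  have "\<exists>a. (\<forall>\<alpha>. a \<alpha> \<in> cblin) \<and> column_bound UNIV M a \<and>
    (\<forall>X\<in>row_ball 1. \<forall>u.
      ((\<lambda>\<alpha>. op_tensor ten (word_op X \<alpha>) (a \<alpha>) u) has_sum F m X u) UNIV)" for m
    by (rule bounded_free_holomorphic[OF infinite_dimensional tensor holomorphic M0 M(2)])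
  then have "\<exists>a. \<forall>m. (\<forall>\<alpha>. a m \<alpha> \<in> cblin) \<and> column_bound UNIV M (a m) \<and>
    (\<forall>X\<in>row_ball 1. \<forall>u.
      ((\<lambda>\<alpha>. op_tensor ten (word_op X \<alpha>) (a m \<alpha>) u) has_sum F m X u) UNIV)"
    by (intro choice allI)
  then obtain a where a: "\<And>m \<alpha>. a m \<alpha> \<in> cblin"
    and a_bound: "\<And>m. column_bound UNIV M (a m)"
    and series: "\<And>m X u. X \<in> row_ball 1 \<Longrightarrow>
      ((\<lambda>\<alpha>. op_tensor ten (word_op X \<alpha>) (a m \<alpha>) u) has_sum F m X u) UNIV"
    by blast
  have Cauchy_coefficients:
    "\<exists>N. \<forall>m\<ge>N. \<forall>j\<ge>N. column_bound {\<alpha>. length \<alpha> < k} \<epsilon> (\<lambda>\<alpha>. a m \<alpha> - a j \<alpha>)"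
    if "0 < \<epsilon>" for \<epsilon> k
    by (rule coefficients_Cauchy[OF infinite_dimensional tensor a a_bound M0 series in_ball
          bounded_below null_sequence pointwise_limit that])
  have "\<exists>l. (\<lambda>m. a m \<alpha>) \<longlonglongrightarrow> l" for \<alpha>
  proof -
    have "Cauchy (\<lambda>m. a m \<alpha>)"
    proof (rule CauchyI)
      fix \<epsilon> :: real
      assume "0 < \<epsilon>"
      then obtain N where N: "\<forall>m\<ge>N. \<forall>j\<ge>N.
          column_bound {\<beta>. length \<beta> < Suc (length \<alpha>)} (\<epsilon> / 2) (\<lambda>\<alpha>. a m \<alpha> - a j \<alpha>)"
        using Cauchy_coefficients[of "\<epsilon> / 2" "Suc (length \<alpha>)"] by auto
      have "norm (a m \<alpha> - a j \<alpha>) < \<epsilon>" if "N \<le> m" "N \<le> j" for m j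
        using column_bound_norm_le[OF N[rule_format, OF that], of \<alpha>] \<open>0 < \<epsilon>\<close> by simp
      then show "\<exists>N. \<forall>m\<ge>N. \<forall>j\<ge>N. norm (a m \<alpha> - a j \<alpha>) < \<epsilon>"
        by blast
    qed
    then show ?thesis
      by (simp add: Cauchy_convergent_iff convergent_def)
  qed
  then have "\<exists>b. \<forall>\<alpha>. (\<lambda>m. a m \<alpha>) \<longlonglongrightarrow> b \<alpha>"
    by (intro choice allI)
  then obtain b where b_lim: "\<And>\<alpha>. (\<lambda>m. a m \<alpha>) \<longlonglongrightarrow> b \<alpha>"
    by blast
  have b: "b \<alpha> \<in> cblin" for \<alpha>
    by (rule cblin_limit[OF a b_lim])
  have b_bound: "column_bound UNIV M b"
    by (rule column_bound_limit[where b = a, OF a_bound b_lim])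
  have "\<exists>T :: 't \<Rightarrow>\<^sub>L 't. \<forall>u. ((\<lambda>\<alpha>. op_tensor ten (word_op X \<alpha>) (b \<alpha>) u) has_sum T u) UNIV"
    if X: "X \<in> row_ball 1" for X
    using free_series_operator[OF tensor b conjunct1[OF row_ball_imp_row_cball[OF X]]
        row_norm_nonneg conjunct2[OF row_ball_imp_row_cball[OF X]] b_bound M0] by blast
  then have "\<forall>X\<in>row_ball 1. \<exists>T :: 't \<Rightarrow>\<^sub>L 't. \<forall>u.
      ((\<lambda>\<alpha>. op_tensor ten (word_op X \<alpha>) (b \<alpha>) u) has_sum T u) UNIV"
    by blast
  from bchoice[OF this] obtain G :: "('n \<Rightarrow> 'h \<Rightarrow>\<^sub>L 'h) \<Rightarrow> ('t \<Rightarrow>\<^sub>L 't)" where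
    G: "\<And>X u. X \<in> row_ball 1 \<Longrightarrow>
      ((\<lambda>\<alpha>. op_tensor ten (word_op X \<alpha>) (b \<alpha>) u) has_sum G X u) UNIV"
    by blast
  have "free_holomorphic ten G"
    by (rule free_holomorphicI[OF tensor b b_bound M0 G])
  moreover have "uniform_limit (row_cball r) F G sequentially" if r: "0 \<le> r" "r < 1" for r
  proof (rule uniform_limitI)
    fix \<epsilon> :: real
    assume "0 < \<epsilon>"
    have "r\<^sup>2 < 1"
      using r by (simp add: power_less_one_iff)
    then have sqrt_pos: "0 < sqrt (1 - r\<^sup>2)"
      by simp
    obtain K where K: "r ^ K / sqrt (1 - r\<^sup>2) * (M + M) < \<epsilon> / 4"
      using order_tendstoD(2)[OF geometric_tail_tendsto_0[OF r, of "M + M"], of "\<epsilon> / 4"] \<open>0 < \<epsilon>\<close>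
      by (auto simp: eventually_sequentially)
    define \<delta> where "\<delta> = sqrt (1 - r\<^sup>2) * (\<epsilon> / 4)"
    have delta: "0 < \<delta>"
      using \<open>0 < \<epsilon>\<close> sqrt_pos by (simp add: \<delta>_def)
    obtain N where N: "\<forall>m\<ge>N. \<forall>j\<ge>N. column_bound {\<alpha>. length \<alpha> < K} \<delta> (\<lambda>\<alpha>. a m \<alpha> - a j \<alpha>)"
      using Cauchy_coefficients[OF delta] by blast
    have "dist (F m X) (G X) < \<epsilon>" if m: "N \<le> m" and X: "X \<in> row_cball r" for m X
    proof -
      define d where "d \<alpha> = a m \<alpha> - b \<alpha>" for \<alpha>
      have X1: "X \<in> row_ball 1"
        using X r by (simp add: row_ball_def row_cball_def)
      have d: "d \<alpha> \<in> cblin" for \<alpha>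
        by (simp add: d_def cblin_diff a b)
      have d_bound: "column_bound UNIV (M + M) d"
        unfolding d_def by (rule column_bound_diff[OF a_bound M0 b_bound M0])
      have low: "column_bound {\<alpha>. length \<alpha> < K} \<delta> d"
        unfolding d_def
      proof (rule column_bound_limit)
        show "column_bound {\<alpha>. length \<alpha> < K} \<delta> (\<lambda>\<alpha>. a m \<alpha> - a j \<alpha>)" if "N \<le> j" for j
          using N m that by blast
        show "(\<lambda>j. a m \<alpha> - a j \<alpha>) \<longlonglongrightarrow> a m \<alpha> - b \<alpha>" for \<alpha>
          by (intro tendsto_intros b_lim)
      qed
      have "norm ((F m X - G X) u) \<le> \<epsilon> / 2 * norm u" for u
      proof -
        have D: "((\<lambda>\<alpha>. op_tensor ten (word_op X \<alpha>) (d \<alpha>) u) has_sum (F m X - G X) u) UNIV"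
          unfolding d_def by (rule series_diff[OF tensor a b X r series[OF X1] G[OF X1]])
        obtain s where s: "((\<lambda>\<alpha>. op_tensor ten (word_op X \<alpha>) (d \<alpha>) u) has_sum s) {\<alpha>. length \<alpha> < K}"
          using free_series_summable[OF tensor d X r low] summable_on_def by blast
        obtain t where t: "((\<lambda>\<alpha>. op_tensor ten (word_op X \<alpha>) (d \<alpha>) u) has_sum t) {\<alpha>. K \<le> length \<alpha>}"
          using free_series_summable[OF tensor d X r column_bound_mono[OF d_bound]] summable_on_def
          by blast
        have "((\<lambda>\<alpha>. op_tensor ten (word_op X \<alpha>) (d \<alpha>) u) has_sum (s + t))
            ({\<alpha>. length \<alpha> < K} \<union> {\<alpha>. K \<le> length \<alpha>})"
          by (rule has_sum_Un_disjoint[OF s t]) auto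
        moreover have "{\<alpha>::'n list. length \<alpha> < K} \<union> {\<alpha>. K \<le> length \<alpha>} = UNIV"
          by auto
        ultimately have "(F m X - G X) u = s + t"
          using D has_sum_unique by metis
        moreover have "norm s \<le> r ^ 0 / sqrt (1 - r\<^sup>2) * \<delta> * norm u"
          by (rule free_series_norm_le[OF tensor d X r low _ _ s]) (use delta in simp_all)
        then have "norm s \<le> \<epsilon> / 4 * norm u"
          using sqrt_pos by (simp add: \<delta>_def)
        moreover have "norm t \<le> r ^ K / sqrt (1 - r\<^sup>2) * (M + M) * norm u"
          by (rule free_series_norm_le[OF tensor d X r column_bound_mono[OF d_bound] _ _ t])
            (use M0 in auto)
        then have "norm t \<le> \<epsilon> / 4 * norm u"
          using mult_right_mono[OF less_imp_le[OF K] norm_ge_zero[of u]] by linarith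
        ultimately show ?thesis
          using norm_triangle_ineq[of s t] by simp
      qed
      then have "norm (F m X - G X) \<le> \<epsilon> / 2"
        using \<open>0 < \<epsilon>\<close> by (intro norm_blinfun_bound) auto
      then show ?thesis
        using \<open>0 < \<epsilon>\<close> by (simp add: dist_norm)
    qed
    then show "\<forall>\<^sub>F m in sequentially. \<forall>X\<in>row_cball r. dist (F m X) (G X) < \<epsilon>"
      unfolding eventually_sequentially by blast
  qed
  ultimately show ?thesis
    by blast
qed

end
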